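(* For all $b\in(0,\infty)$ and $c\in(0,1)$, with $d:=\sqrt{1-c}$, $$\sum_{n=1}^\infty \frac{(bc)^n}{(n-1)!\,2^n}\Big(J'_{n-\frac12}(b)-(-1)^nH'_{\frac12-n}(b)\Big)=\frac{2c}{d}\sqrt{\frac{b}{2\pi}}\Big(\sin(bd)\,\mathrm{Ci}(bd)-\cos(bd)\,\mathrm{Si}(bd)\Big),$$ where the derivative $'$ refers to the order of the Bessel and Struve functions, i.e. $J'_{n-\frac12}(b)=\frac{\partial}{\partial\alpha}J_\alpha(b)\big|_{\alpha=n-\frac12}$ and $H'_{\frac12-n}(b)=\frac{\partial}{\partial\alpha}H_\alpha(b)\big|_{\alpha=\frac12-n}$. In particular, in the special case $b=2$, for all $c\in(0,1)$, with $d=\sqrt{1-c}$, $$\sum_{n=1}^\infty\frac{c^n}{(n-1)!}\Big(J'_{n-\frac12}(2)-(-1)^nH'_{\frac12-n}(2)\Big)=\frac{2c}{d\sqrt{\pi}}\Big(\sin(2d)\,\mathrm{Ci}(2d)-\cos(2d)\,\mathrm{Si}(2d)\Big).$$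
   Context: For $z>0$ and $\alpha\in\mathbb{R}$, the Bessel function of the first kind is $$J_\alpha(z):=\sum_{n=0}^\infty\frac{(-1)^n}{n!\,\Gamma(n+\alpha+1)}\left(\frac z2\right)^{2n+\alpha},$$ and the Struve function is $$H_\alpha(z):=\sum_{n=0}^\infty\frac{(-1)^n}{\Gamma\left(n+\frac32\right)\Gamma\left(n+\alpha+\frac32\right)}\left(\frac z2\right)^{2n+\alpha+1},$$ where $\Gamma$ is the Gamma function and $1/\Gamma$ is the entire reciprocal Gamma function, which takes the value $0$ at $0,-1,-2,\dots$. For each fixed $z>0$, the functions $\alpha\mapsto J_\alpha(z)$ and $\alpha\mapsto H_\alpha(z)$ are continuously differentiable on $\mathbb{R}$. The sine and cosine integrals are $\mathrm{Si}(z):=\int_0^z\frac{\sin t}{t}\,dt$ and $\mathrm{Ci}(z):=-\int_z^\infty\frac{\cos t}{t}\,dt$ for $z>0$ (the latter as a convergent improper integral). *)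

theory Defs
  imports "HOL-Probability.Sinc_Integral"
begin

text \<open>
  Both functions are meant for \<open>z > 0\<close>; then \<open>z / 2 > 0\<close> and \<open>powr\<close> is the real power.
  \<open>rGamma\<close> is the entire reciprocal Gamma function.
\<close>

definition Bessel_J :: "real \<Rightarrow> real \<Rightarrow> real" where
  "Bessel_J \<alpha> z =
     (\<Sum>n. (-1) ^ n / fact n * rGamma (real n + \<alpha> + 1) * (z / 2) powr (2 * real n + \<alpha>))"

definition Struve_H :: "real \<Rightarrow> real \<Rightarrow> real" where
  "Struve_H \<alpha> z =
     (\<Sum>n. (-1) ^ n * rGamma (real n + 3 / 2) * rGamma (real n + \<alpha> + 3 / 2)
            * (z / 2) powr (2 * real n + \<alpha> + 1))"

definition Bessel_J_deriv :: "real \<Rightarrow> real \<Rightarrow> real" where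
  "Bessel_J_deriv \<alpha> z = deriv (\<lambda>\<nu>. Bessel_J \<nu> z) \<alpha>"

definition Struve_H_deriv :: "real \<Rightarrow> real \<Rightarrow> real" where
  "Struve_H_deriv \<alpha> z = deriv (\<lambda>\<nu>. Struve_H \<nu> z) \<alpha>"

text \<open>
  The sine integral is \<open>Si\<close> of \<open>HOL-Probability.Sinc_Integral\<close>. The integral in \<open>Ci\<close> is not
  absolutely convergent, so a Lebesgue integral over \<open>z..\<infinity>\<close> would not do: it is the limit of
  the integrals over \<open>z..T\<close>.
\<close>

definition Ci :: "real \<Rightarrow> real" where
  "Ci z = - Lim at_top (\<lambda>T::real. LBINT t=z..T. cos t / t)"

end

theory Submission
  imports Defs
begin

text \<open>
  Write \<open>g\<close> for the entire function \<open>1 / \<Gamma>\<close>, \<open>w = b / 2\<close> and \<open>n = m + 1\<close>. The Bessel series at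
  order \<open>m + 1/2\<close>, re-indexed by \<open>k = j + m\<close>, has the coefficients
  \<open>g (k + 1 - m) * g (k + 3/2)\<close>: the factor \<open>g (k + 1 - m)\<close> is the usual \<open>1 / j!\<close>, and it
  vanishes for \<open>k < m\<close>. The Struve series at order \<open>- m - 1/2\<close> has the same coefficients up to
  sign. Only the factor that carries the order differs: \<open>g (k + 3/2)\<close> for Bessel,
  \<open>g (k + 1 - m)\<close> for Struve. Hence the combination of the two order derivatives is the
  derivative by the product rule of one series, and the summand for \<open>m\<close>, with its weight
  \<open>(w c)^(m+1) / m!\<close>, is a sum over \<open>k\<close> in which \<open>m\<close> occurs only through
  \<open>(-c)^m / m!\<close> and \<open>g\<close>, \<open>g'\<close> at \<open>k + 1 - m\<close>.

  The double series converges absolutely, so that the sum over \<open>m\<close> may be taken first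
  (\<open>sums_swap\<close>). That inner sum is the binomial series
  \<open>\<Sum>m. (-c)^m / m! * g (y - m) = (1 - c)^(y - 1) * g y\<close> and its derivative in \<open>y\<close>, at
  \<open>y = k + 1\<close> (\<open>binomial_rGamma_sums\<close>, \<open>binomial_rGamma_deriv_sums\<close>). The powers of
  \<open>1 - c = d^2\<close> turn \<open>b\<close> into \<open>x = b d\<close>, and the term \<open>ln (1 - c)\<close> from the derivative turns
  \<open>2 * ln w\<close> into \<open>2 * ln (x / 2)\<close>.

  What is left is one series in \<open>x\<close>. The duplication formulas for \<open>\<Gamma>\<close> and its logarithmic
  derivative change it, up to the factor \<open>4 / (sqrt \<pi> * x)\<close>, to the series
  \<open>\<Sum>j. (-1)^j * x^(2j+1) / (2j+1)! * (ln x + \<gamma> - H (2j+1))\<close>, where \<open>H\<close> are the harmonic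
  numbers. This is \<open>sin x * Ci x - cos x * Si x\<close> (\<open>sin_Ci_minus_cos_Si_sums\<close>), for two reasons:
  the sine and cosine series weighted with harmonic numbers solve a rotating linear system of
  differential equations that is driven by the integrands of \<open>Si\<close> and of
  \<open>Cin x = \<integral>\<^sub>0\<^sup>x (1 - cos t) / t\<close>; and \<open>Ci x = \<gamma> + ln x - Cin x\<close> (\<open>Ci_eq\<close>). The last equation
  amounts to \<open>Cin T - ln T \<longlonglongrightarrow> \<gamma>\<close>. On \<open>{0..\<pi>/2}\<close> the integral of
  \<open>(1 - cos (4 n t)) * cot t\<close> is the sum of \<open>2 / (2 k + 1)\<close> over \<open>k < n\<close>, and the replacement
  of \<open>cot t\<close> by \<open>1 / t\<close> costs \<open>ln (\<pi> / 2)\<close> and an oscillatory integral that tends to \<open>0\<close>.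
\<close>

section \<open>Sine and cosine series weighted with harmonic numbers\<close>

definition sin_harm :: "real \<Rightarrow> real" where
  "sin_harm x = (\<Sum>n. sin_coeff n * harm n * x ^ n)"

definition cos_harm :: "real \<Rightarrow> real" where
  "cos_harm x = (\<Sum>n. cos_coeff n * harm n * x ^ n)"

lemma summable_harm_powser:
  fixes a :: "nat \<Rightarrow> real" and x :: real
  assumes "\<And>n. \<bar>a n\<bar> \<le> 1 / fact n"
  shows "summable (\<lambda>n. a n * harm n * x ^ n)"
proof (rule summable_comparison_test)
  show "summable (\<lambda>n. inverse (fact n) * (2 * \<bar>x\<bar>) ^ n)" by (rule summable_exp)
  have "norm (a n * harm n * x ^ n) \<le> inverse (fact n) * (2 * \<bar>x\<bar>) ^ n" for n
  proof -
    have "harm n \<le> (\<Sum>k=1..n. 1 :: real)" unfolding harm_def by (intro sum_mono) (simp add: field_simps)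
    also have "\<dots> \<le> 2 ^ n" using of_nat_less_two_power[of n, where 'a = real] by simp
    finally have "\<bar>a n\<bar> * harm n * \<bar>x\<bar> ^ n \<le> (1 / fact n) * 2 ^ n * \<bar>x\<bar> ^ n"
      using assms[of n] harm_nonneg[of n] by (intro mult_mono) auto
    then show ?thesis
      using harm_nonneg[of n, where 'a = real]
      by (simp add: abs_mult power_abs power_mult_distrib divide_inverse mult_ac)
  qed
  then show "\<exists>N. \<forall>n\<ge>N. norm (a n * harm n * x ^ n) \<le> inverse (fact n) * (2 * \<bar>x\<bar>) ^ n" by blast
qed

lemma abs_sin_coeff_le: "\<bar>sin_coeff n\<bar> \<le> 1 / fact n"
  and abs_cos_coeff_le: "\<bar>cos_coeff n\<bar> \<le> 1 / fact n"
  by (simp_all add: sin_coeff_def cos_coeff_def abs_mult)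

lemma sums_sin_harm: "(\<lambda>n. sin_coeff n * harm n * x ^ n) sums sin_harm x"
  unfolding sin_harm_def by (intro summable_sums summable_harm_powser abs_sin_coeff_le)

lemma sums_cos_harm: "(\<lambda>n. cos_coeff n * harm n * x ^ n) sums cos_harm x"
  unfolding cos_harm_def by (intro summable_sums summable_harm_powser abs_cos_coeff_le)

lemma sums_sin_coeff_Suc: "(\<lambda>n. sin_coeff (Suc n) * x ^ n) sums sinc x"
proof (cases "x = 0")
  case True
  then show ?thesis using powser_sums_zero[of "\<lambda>n. sin_coeff (Suc n)"] by (simp add: sin_coeff_Suc)
next
  case False
  have "(\<lambda>n. sin_coeff (Suc n) * x ^ Suc n) sums sin x"
    using sin_converges[of x] by (subst sums_Suc_iff) simp
  from sums_divide[OF this, of x] show ?thesis using False by simp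
qed

lemma sums_cos_coeff_Suc: "(\<lambda>n. cos_coeff (Suc n) * x ^ n) sums ((cos x - 1) / x)"
proof (cases "x = 0")
  case True
  then show ?thesis using powser_sums_zero[of "\<lambda>n. cos_coeff (Suc n)"] by (simp add: cos_coeff_Suc)
next
  case False
  have "(\<lambda>n. cos_coeff (Suc n) * x ^ Suc n) sums (cos x - 1)"
    using cos_converges[of x] by (subst sums_Suc_iff) simp
  from sums_divide[OF this, of x] show ?thesis using False by simp
qed

text \<open>
  Differentiation multiplies the coefficients by \<open>n + 1\<close>, and \<open>harm (n +
  1)\<close> exceeds \<open>harm n\<close> by \<open>1 / (n + 1)\<close>. So the derivative
  is the one known from sine and cosine, plus the ordinary sine series shifted by one place.
\<close>
lemma DERIV_sin_harm: "(sin_harm has_real_derivative cos_harm x + sinc x) (at x)"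
proof -
  have "diffs (\<lambda>n. sin_coeff n * harm n) n = cos_coeff n * harm n + sin_coeff (Suc n)" for n
  proof -
    have "real (Suc n) * sin_coeff (Suc n) = cos_coeff n" by (simp add: sin_coeff_Suc del: of_nat_Suc)
    moreover have "real (Suc n) * (sin_coeff (Suc n) * (harm n + inverse (real (Suc n))))
        = (real (Suc n) * sin_coeff (Suc n)) * harm n + sin_coeff (Suc n)"
      by (simp add: ring_distribs del: of_nat_Suc)
    ultimately show ?thesis by (simp add: diffs_def harm_Suc del: of_nat_Suc)
  qed
  then have "(\<lambda>n. diffs (\<lambda>n. sin_coeff n * harm n) n * x ^ n) sums (cos_harm x + sinc x)"
    using sums_add[OF sums_cos_harm sums_sin_coeff_Suc] by (simp add: algebra_simps)
  moreover have "(sin_harm has_real_derivative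
      (\<Sum>n. diffs (\<lambda>n. sin_coeff n * harm n) n * x ^ n)) (at x)"
    unfolding sin_harm_def
    by (intro termdiffs_strong_converges_everywhere summable_harm_powser abs_sin_coeff_le)
  ultimately show ?thesis by (simp add: sums_iff)
qed

lemma DERIV_cos_harm: "(cos_harm has_real_derivative - sin_harm x + (cos x - 1) / x) (at x)"
proof -
  have eq: "diffs (\<lambda>n. cos_coeff n * harm n) n = - (sin_coeff n * harm n) + cos_coeff (Suc n)" for n
  proof -
    have "real (Suc n) * cos_coeff (Suc n) = - sin_coeff n" by (simp add: cos_coeff_Suc del: of_nat_Suc)
    moreover have "real (Suc n) * (cos_coeff (Suc n) * (harm n + inverse (real (Suc n))))
        = (real (Suc n) * cos_coeff (Suc n)) * harm n + cos_coeff (Suc n)"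
      by (simp add: ring_distribs del: of_nat_Suc)
    ultimately show ?thesis by (simp add: diffs_def harm_Suc del: of_nat_Suc)
  qed
  have "(\<lambda>n. diffs (\<lambda>n. cos_coeff n * harm n) n * x ^ n) sums (- sin_harm x + (cos x - 1) / x)"
    using sums_add[OF sums_minus[OF sums_sin_harm] sums_cos_coeff_Suc]
    by (simp only: eq distrib_right mult_minus_left)
  moreover have "(cos_harm has_real_derivative
      (\<Sum>n. diffs (\<lambda>n. cos_coeff n * harm n) n * x ^ n)) (at x)"
    unfolding cos_harm_def
    by (intro termdiffs_strong_converges_everywhere summable_harm_powser abs_cos_coeff_le)
  ultimately show ?thesis by (simp add: sums_iff)
qed

lemma sin_harm_0: "sin_harm 0 = 0" and cos_harm_0: "cos_harm 0 = 0"
  unfolding sin_harm_def cos_harm_def by (simp_all add: harm_def)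

text \<open>
  The entire cosine integral, the integral of \<open>(1 - cos t) / t\<close> from
  \<open>0\<close> to \<open>x\<close>. It is the component of the vector \<open>(cos_harm
  x, sin_harm x)\<close> along \<open>(cos x, sin x)\<close>; the component along the normal
  is \<open>Si\<close>. In these rotating coordinates the homogeneous part of the
  differential equations disappears and only the driving terms remain.
\<close>
definition Cin :: "real \<Rightarrow> real" where
  "Cin x = sin_harm x * sin x + cos_harm x * cos x"

lemma Cin_0: "Cin 0 = 0"
  by (simp add: Cin_def cos_harm_0)

text \<open>
  At \<open>x = 0\<close> the default value \<open>0 / 0 = 0\<close> is the true derivative.
\<close>
lemma DERIV_Cin: "(Cin has_real_derivative (1 - cos x) / x) (at x)"
proof (cases "x = 0")
  case True
  then show ?thesis unfolding Cin_def
    by (auto intro!: derivative_eq_intros DERIV_sin_harm DERIV_cos_harm simp: sin_harm_0 cos_harm_0)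
next
  case False
  have "(Cin has_real_derivative sin x / x * sin x + (cos x - 1) / x * cos x) (at x)"
    unfolding Cin_def using False
    by (auto intro!: derivative_eq_intros DERIV_sin_harm DERIV_cos_harm simp: algebra_simps)
  moreover have "sin x / x * sin x + (cos x - 1) / x * cos x = (1 - cos x) / x"
    using False sin_cos_squared_add[of x]
    by (simp add: divide_simps) (simp add: algebra_simps power2_eq_square)
  ultimately show ?thesis by simp
qed

lemma Si_eq_harm: "Si x = sin_harm x * cos x - cos_harm x * sin x"
proof -
  let ?D = "\<lambda>x. sin_harm x * cos x - cos_harm x * sin x - Si x"
  have "(?D has_real_derivative 0) (at t)" for t
    by (auto intro!: derivative_eq_intros DERIV_sin_harm DERIV_cos_harm DERIV_Si
          simp: sin_harm_0 cos_harm_0 field_simps)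
  from DERIV_isconst_all[of ?D x 0] this have "?D x = ?D 0" by blast
  then show ?thesis by (simp add: sin_harm_0 cos_harm_0 Si_def zero_ereal_def)
qed

lemma sin_harm_eq: "sin_harm x = sin x * Cin x + cos x * Si x"
  using sin_cos_squared_add[of x] unfolding Cin_def Si_eq_harm by algebra

section \<open>The logarithmic asymptotics of the cosine integral\<close>

text \<open>
  The sum over odd denominators is the full harmonic sum without its even terms. It occurs
  both in the value of a trigonometric integral and in the digamma function at
  half-integers.
\<close>
lemma sum_odd_reciprocals: "(\<Sum>k<n. 2 / (2 * real k + 1)) = 2 * harm (2 * n) - harm n"
proof (induction n)
  case (Suc n)
  have h: "harm (2 * Suc n) = harm (2 * n) + inverse (2 * real n + 1) + inverse (2 * real n + 2)"
    by (simp add: harm_Suc add_ac)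
  have i: "inverse (2 * real n + 2) = inverse (real n + 1) / 2" by (simp add: field_simps)
  have h1: "harm (Suc n) = harm n + inverse (real n + 1)" by (simp add: harm_Suc add.commute)
  have "(\<Sum>k<Suc n. 2 / (2 * real k + 1)) = (\<Sum>k<n. 2 / (2 * real k + 1)) + 2 * inverse (2 * real n + 1)"
    by (simp add: divide_inverse)
  then show ?case unfolding Suc h h1 i by (simp only: distrib_left)
qed (simp add: harm_def)

text \<open>
  This integral can be computed exactly because the factor \<open>sin t\<close> cancels in
  the difference of the integrands for \<open>n + 1\<close> and \<open>n\<close>, which
  leaves three sines of multiples of \<open>t\<close>. The multiple \<open>4 n\<close> makes
  two of them integrate to \<open>0\<close>.
\<close>
lemma has_integral_one_minus_cos_cot:
  "((\<lambda>t. (1 - cos (4 * real n * t)) * cot t) has_integral (\<Sum>k<n. 2 / (2 * real k + 1))) {0..pi / 2}"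
proof (induction n)
  case 0
  show ?case by simp
next
  case (Suc n)
  have sin_int: "((\<lambda>t. sin (a * t)) has_integral (1 - cos (a * (pi / 2))) / a) {0..pi / 2}" for a :: real
  proof (cases "a = 0")
    case False
    then have "((\<lambda>t. sin (a * t)) has_integral (- cos (a * (pi / 2)) / a - (- cos (a * 0) / a))) {0..pi / 2}"
      by (intro fundamental_theorem_of_calculus)
         (auto intro!: derivative_eq_intros simp flip: has_real_derivative_iff_has_vector_derivative)
    then show ?thesis by (simp add: diff_divide_distrib)
  qed simp
  have c1: "cos ((4 * real n + 2) * (pi / 2)) = - 1"
  proof -
    have "(4 * real n + 2) * (pi / 2) = real (2 * n + 1) * pi" by (simp add: algebra_simps)
    then show ?thesis by (simp only: cos_npi) simp
  qed
  have c2: "cos ((4 * real n + 4) * (pi / 2)) = 1"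
  proof -
    have "(4 * real n + 4) * (pi / 2) = real (2 * n + 2) * pi" by (simp add: algebra_simps)
    then show ?thesis by (simp only: cos_npi) simp
  qed
  have c3: "cos (4 * real n * (pi / 2)) = 1"
  proof -
    have "4 * real n * (pi / 2) = real (2 * n) * pi" by (simp add: algebra_simps)
    then show ?thesis by (simp only: cos_npi) simp
  qed
  have val: "4 / (4 * real n + 2) = 2 / (2 * real n + 1)" by (simp add: divide_simps)
  have step: "((\<lambda>t. 2 * sin ((4 * real n + 2) * t) + sin ((4 * real n + 4) * t) + sin (4 * real n * t))
      has_integral 2 / (2 * real n + 1)) {0..pi / 2}"
    using has_integral_add[OF has_integral_add[OF
        has_integral_mult_right[OF sin_int[of "4 * real n + 2"], of 2]
        sin_int[of "4 * real n + 4"]] sin_int[of "4 * real n"]]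
    unfolding c1 c2 c3 by (simp add: val)
  have eq: "(1 - cos (4 * real n * t)) * cot t
       + (2 * sin ((4 * real n + 2) * t) + sin ((4 * real n + 4) * t) + sin (4 * real n * t))
     = (1 - cos (4 * real (Suc n) * t)) * cot t" if t: "t \<in> {0..pi / 2}" for t
  proof (cases "t = 0")
    case False
    then have s: "sin t \<noteq> 0" using t by (smt (verit) atLeastAtMost_iff pi_gt_zero sin_gt_zero field_sum_of_halves)
    \<comment> \<open>The angle halfway between \<open>4 n t\<close> and \<open>4 (n + 1) t\<close>.\<close>
    define a where "a = (4 * real n + 2) * t"
    have e: "4 * real n * t = a - 2 * t" "4 * real (Suc n) * t = a + 2 * t"
      "(4 * real n + 4) * t = a + 2 * t"
      unfolding a_def by (simp_all add: algebra_simps)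
    have "(cos (a - 2 * t) - cos (a + 2 * t)) * cot t = 4 * sin a * (cos t)^2"
      using s by (simp add: cos_diff cos_add sin_double cot_def power2_eq_square)
    moreover have "2 * sin a + sin (a + 2 * t) + sin (a - 2 * t) = 4 * sin a * (cos t)^2"
      by (simp add: sin_add sin_diff cos_double_cos) (simp add: algebra_simps)
    ultimately show ?thesis
      unfolding e a_def[symmetric] by (simp add: algebra_simps)
  qed simp
  show ?case
    using has_integral_eq[OF eq has_integral_add[OF Suc step]] by simp
qed

text \<open>
  Monotonicity makes the second mean value theorem applicable to oscillatory integrals
  against this function. At \<open>t = 0\<close> the convention \<open>1 / 0 - cot 0 =
  0\<close> gives the limit.
\<close>
lemma inverse_minus_cot_mono: "mono_on {0..pi / 2} (\<lambda>t::real. 1 / t - cot t)"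
proof (rule mono_onI)
  have nonneg: "1 / t - cot t \<ge> 0" if "0 < t" "t \<le> pi / 2" for t :: real
  proof -
    have s: "sin t > 0" using that pi_gt_zero by (intro sin_gt_zero) linarith+
    have "t * cos t \<le> sin t"
    proof -
      have "sin 0 - 0 * cos 0 \<le> sin t - t * cos t"
      proof (rule DERIV_nonneg_imp_nondecreasing[of 0 t "\<lambda>x. sin x - x * cos x"])
        fix x :: real assume "0 \<le> x" "x \<le> t"
        then have "0 \<le> sin x" using that pi_gt_zero by (intro sin_ge_zero) linarith+
        then show "\<exists>y. ((\<lambda>x. sin x - x * cos x) has_real_derivative y) (at x) \<and> 0 \<le> y"
          using \<open>0 \<le> x\<close> by (intro exI[of _ "x * sin x"]) (auto intro!: derivative_eq_intros)
      qed (use that in auto)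
      then show ?thesis by simp
    qed
    then show ?thesis using s that by (simp add: cot_def field_simps)
  qed
  fix r s :: real assume rs: "r \<in> {0..pi / 2}" "s \<in> {0..pi / 2}" "r \<le> s"
  show "1 / r - cot r \<le> 1 / s - cot s"
  proof (cases "r = 0")
    case True
    then show ?thesis using nonneg[of s] rs by (cases "s = 0") auto
  next
    case False
    show ?thesis
    proof (rule DERIV_nonneg_imp_nondecreasing[of r s "\<lambda>t. 1 / t - cot t"])
      fix x assume x: "r \<le> x" "x \<le> s"
      have s: "sin x > 0" using x False rs pi_gt_zero by (intro sin_gt_zero) (simp_all, linarith?)
      have "sin x \<le> x" using x rs by (intro sin_x_le_x) auto
      then have "(sin x)^2 \<le> x^2" using s by (intro power_mono) auto
      then have "0 \<le> - 1 / x^2 + 1 / (sin x)^2"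
        using s x rs False by (simp add: divide_simps)
      moreover have "((\<lambda>t. 1 / t - cot t) has_real_derivative - 1 / x^2 + 1 / (sin x)^2) (at x)"
        using DERIV_diff[OF DERIV_inverse[of x] DERIV_cot[of x]] s x rs False
        by (simp add: inverse_eq_divide power2_eq_square)
      ultimately show "\<exists>y. ((\<lambda>t. 1 / t - cot t) has_real_derivative y) (at x) \<and> 0 \<le> y" by blast
    qed (use rs in auto)
  qed
qed

text \<open>
  The antiderivative is \<open>- ln (sin t / t)\<close>, which \<open>sinc\<close> extends
  continuously to \<open>0\<close>.
\<close>
lemma has_integral_inverse_minus_cot:
  "((\<lambda>t::real. 1 / t - cot t) has_integral ln (pi / 2)) {0..pi / 2}"
proof -
  have "((\<lambda>t::real. 1 / t - cot t) has_integral (- ln (sinc (pi / 2)) - (- ln (sinc 0)))) {0..pi / 2}"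
  proof (rule fundamental_theorem_of_calculus_interior)
    have "sinc t > 0" if "t \<in> {0..pi / 2}" for t
      using that sin_gt_zero[of t] pi_gt_zero by auto
    then show "continuous_on {0..pi / 2} (\<lambda>t. - ln (sinc t))"
      by (intro continuous_intros) fastforce+
    fix x assume x: "x \<in> {0<..<pi / 2}"
    then have s: "sin x > 0" using sin_gt_zero[of x] by auto
    have "((\<lambda>t. - ln (sin t / t)) has_real_derivative 1 / x - cot x) (at x)"
      using x s by (auto intro!: derivative_eq_intros simp: cot_def field_simps)
    then have "((\<lambda>t. - ln (sinc t)) has_real_derivative 1 / x - cot x) (at x)"
      by (rule has_field_derivative_transform_within_open[where S = "{0<..}"]) (use x in auto)
    then show "((\<lambda>t. - ln (sinc t)) has_vector_derivative 1 / x - cot x) (at x)"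
      by (simp add: has_real_derivative_iff_has_vector_derivative)
  qed (use pi_gt_zero in auto)
  then show ?thesis by (simp add: ln_div)
qed

text \<open>
  After the substitution of \<open>4 n t\<close>, this is the integral of \<open>(1 - cos (4
  n t)) / t\<close> over \<open>{0..\<pi>/2}\<close>. With \<open>cot t\<close> in the place
  of \<open>1 / t\<close> it is known exactly; the difference \<open>1 / t - cot t\<close>
  contributes its integral and an oscillatory part \<open>e\<close> of order \<open>1 /
  n\<close>.
\<close>
lemma Cin_at_even_multiples_of_pi:
  assumes "n > 0"
  shows "\<bar>Cin (2 * real n * pi) - (2 * harm (2 * n) - harm n) - ln (pi / 2)\<bar> \<le> 1 / real n"
proof -
  let ?h = "\<lambda>t::real. 1 / t - cot t" and ?k = "\<lambda>t. cos (4 * real n * t)"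
  have k_int: "(?k has_integral (sin (4 * real n * v) / (4 * real n) - sin (4 * real n * u) / (4 * real n))) {u..v}"
    if "u \<le> v" for u v
    using that assms
    by (intro fundamental_theorem_of_calculus)
       (auto intro!: derivative_eq_intros simp flip: has_real_derivative_iff_has_vector_derivative
             simp: field_simps)
  have "?k integrable_on {0..pi / 2}"
    using k_int[of 0 "pi / 2"] pi_gt_zero by (auto simp: integrable_on_def)
  moreover have "?h x \<le> ?h y" if "0 \<le> x" "x \<le> y" "y \<le> pi / 2" for x y
    using mono_onD[OF inverse_minus_cot_mono, of x y] that by simp
  ultimately obtain c where c: "c \<in> {0..pi / 2}" and
    E: "((\<lambda>t. ?h t * ?k t) has_integral
           (?h 0 * integral {0..c} ?k + ?h (pi / 2) * integral {c..pi / 2} ?k)) {0..pi / 2}"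
    using second_mean_value_theorem_full[of ?k 0 "pi / 2" ?h] pi_gt_zero by force
  define e where "e = ?h 0 * integral {0..c} ?k + ?h (pi / 2) * integral {c..pi / 2} ?k"
  \<comment> \<open>The first part vanishes because \<open>1 / 0 - cot 0 = 0\<close>.\<close>
  have "e = (2 / pi) * (sin (4 * real n * (pi / 2)) / (4 * real n) - sin (4 * real n * c) / (4 * real n))"
    using integral_unique[OF k_int[of c "pi / 2"]] c by (simp add: e_def cot_def)
  then have e_eq: "e = - (sin (4 * real n * c) / (2 * pi * real n))"
    using sin_npi[of "2 * n"] assms by (simp add: field_simps)
  have "\<bar>sin (4 * real n * c)\<bar> * 1 \<le> 1 * (2 * pi)"
    using pi_ge_two by (intro mult_mono) auto
  then have e_le: "\<bar>e\<bar> \<le> 1 / real n"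
    unfolding e_eq using assms by (simp add: abs_mult field_simps)
  have "((\<lambda>t. (1 - ?k t) / t) has_integral (Cin (4 * real n * (pi / 2)) - Cin (4 * real n * 0))) {0..pi / 2}"
  proof (rule fundamental_theorem_of_calculus)
    fix t assume "t \<in> {0..pi / 2}"
    have "((\<lambda>t. Cin (4 * real n * t)) has_real_derivative
            (1 - ?k t) / (4 * real n * t) * (4 * real n)) (at t within {0..pi / 2})"
      by (intro DERIV_chain2[OF DERIV_Cin]) (auto intro!: derivative_eq_intros)
    then show "((\<lambda>t. Cin (4 * real n * t)) has_vector_derivative (1 - ?k t) / t) (at t within {0..pi / 2})"
      using assms by (simp flip: has_real_derivative_iff_has_vector_derivative)
  qed (use pi_gt_zero in auto)
  then have I1: "((\<lambda>t. (1 - ?k t) / t) has_integral Cin (2 * real n * pi)) {0..pi / 2}"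
    by (simp add: Cin_0 mult_ac)
  have I2: "((\<lambda>t. (1 - ?k t) / t) has_integral
      (\<Sum>k<n. 2 / (2 * real k + 1)) + (ln (pi / 2) - e)) {0..pi / 2}"
    using has_integral_add[OF has_integral_one_minus_cos_cot[of n]
        has_integral_diff[OF has_integral_inverse_minus_cot E[folded e_def]]]
    by (simp add: algebra_simps diff_divide_distrib)
  have "Cin (2 * real n * pi) = 2 * harm (2 * n) - harm n + (ln (pi / 2) - e)"
    using has_integral_unique[OF I1 I2] unfolding sum_odd_reciprocals .
  then show ?thesis using e_le by simp
qed

text \<open>
  Along \<open>2 n \<pi>\<close> the constants \<open>ln 2\<close> and \<open>ln
  \<pi>\<close> cancel and Euler's constant remains. Between two such points \<open>Cin -
  ln\<close> changes little, since its derivative is \<open>- cos x / x\<close>.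
\<close>
lemma Cin_minus_ln_limit: "((\<lambda>T. Cin T - ln T) \<longlongrightarrow> euler_mascheroni) at_top"
proof -
  define a where "a n = Cin (2 * real n * pi) - ln (2 * real n * pi)" for n :: nat
  have inv0: "(\<lambda>n. 1 / real n) \<longlonglongrightarrow> 0" by (rule lim_1_over_n)
  have a_lim: "a \<longlonglongrightarrow> euler_mascheroni"
  proof -
    \<comment> \<open>Both differences tend to \<open>euler_mascheroni\<close>, and \<open>u n\<close> differs from \<open>a n\<close> by \<open>O(1 / n)\<close>.\<close>
  define u where "u n = 2 * (harm (2 * n) - ln (real (2 * n))) - (harm n - ln (real n))" for n :: nat
    have "u \<longlonglongrightarrow> 2 * euler_mascheroni - euler_mascheroni"
      unfolding u_def
      by (intro tendsto_intros euler_mascheroni_LIMSEQ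
            filterlim_compose[OF euler_mascheroni_LIMSEQ, of "\<lambda>n. 2 * n"] mult_nat_left_at_top) simp
    then have u_lim: "u \<longlonglongrightarrow> euler_mascheroni" by simp
    have "(\<lambda>n. a n - u n) \<longlonglongrightarrow> 0"
    proof (rule Lim_null_comparison[OF _ inv0])
      show "\<forall>\<^sub>F n in sequentially. norm (a n - u n) \<le> 1 / real n"
        using eventually_gt_at_top[of 0]
      proof eventually_elim
        case (elim n)
        have "a n - u n = Cin (2 * real n * pi) - (2 * harm (2 * n) - harm n) - ln (pi / 2)"
          using elim by (simp add: a_def u_def ln_mult ln_div algebra_simps)
        then show ?case using Cin_at_even_multiples_of_pi[OF elim] by simp
      qed
    qed
    from tendsto_add[OF this u_lim] show ?thesis by simp
  qed
  \<comment> \<open>The last multiple of \<open>2 * pi\<close> before \<open>T\<close>.\<close>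
  define N where "N T = nat \<lfloor>T / (2 * pi)\<rfloor>" for T
  have N_lim: "filterlim N sequentially at_top"
  proof -
    have "filterlim (\<lambda>T::real. T * (1 / (2 * pi))) at_top at_top"
      using filterlim_tendsto_pos_mult_at_top[OF tendsto_const, of "1 / (2 * pi)" "\<lambda>T. T" at_top]
      by (simp add: filterlim_ident mult.commute)
    then show ?thesis
      unfolding N_def
      by (intro filterlim_compose[OF filterlim_nat_sequentially]
            filterlim_compose[OF filterlim_floor_sequentially]) simp
  qed
  have "((\<lambda>T. Cin T - ln T - a (N T)) \<longlongrightarrow> 0) at_top"
  proof (rule Lim_null_comparison)
    show "((\<lambda>T. 1 / real (N T)) \<longlongrightarrow> 0) at_top"
      using filterlim_compose[OF inv0 N_lim] .
    show "\<forall>\<^sub>F T in at_top. norm (Cin T - ln T - a (N T)) \<le> 1 / real (N T)"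
      using eventually_ge_at_top[of "2 * pi"]
    proof eventually_elim
      case (elim T)
      define p where "p = 2 * real (N T) * pi"
      have "1 \<le> T / (2 * pi)" using elim by simp
      then have fl: "1 \<le> \<lfloor>T / (2 * pi)\<rfloor>" by simp
      then have N1: "real (N T) \<ge> 1" and Nf: "real (N T) = of_int \<lfloor>T / (2 * pi)\<rfloor>"
        unfolding N_def by linarith+
      have "real (N T) \<le> T / (2 * pi)" "T / (2 * pi) \<le> real (N T) + 1"
        unfolding Nf by linarith+
      then have p: "p \<le> T" "T \<le> p + 2 * pi" by (simp_all add: p_def field_simps)
      have p0: "p > 0" using N1 by (simp add: p_def)
      have "norm ((Cin T - ln T) - (Cin p - ln p)) \<le> (1 / p) * norm (T - p)"
      proof (rule field_differentiable_bound[where S = "{p..T}" and f' = "\<lambda>x. - cos x / x"])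
        fix x assume x: "x \<in> {p..T}"
        then show "((\<lambda>x. Cin x - ln x) has_field_derivative - cos x / x) (at x within {p..T})"
          using p0 by (auto intro!: derivative_eq_intros has_field_derivative_at_within[OF DERIV_Cin]
              simp: field_simps)
        have "\<bar>cos x\<bar> / x \<le> 1 / p"
          using x p0 by (intro frac_le) auto
        then show "norm (- cos x / x) \<le> 1 / p" using x p0 by simp
      qed (use p in auto)
      also have "\<dots> \<le> (1 / p) * (2 * pi)" using p p0 by (intro mult_left_mono) auto
      also have "\<dots> = 1 / real (N T)" using N1 by (simp add: p_def)
      finally show ?case by (simp add: a_def p_def)
    qed
  qed
  from tendsto_add[OF this filterlim_compose[OF a_lim N_lim]] show ?thesis by simp
qed

lemma Ci_eq:
  assumes "x > 0"
  shows "Ci x = euler_mascheroni + ln x - Cin x"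
proof -
  have "((\<lambda>T::real. LBINT t=x..T. cos t / t) \<longlongrightarrow> Cin x - ln x - euler_mascheroni) at_top"
  proof (rule Lim_transform_eventually)
    show "((\<lambda>T. (Cin x - ln x) - (Cin T - ln T)) \<longlongrightarrow> Cin x - ln x - euler_mascheroni) at_top"
      by (rule tendsto_diff[OF tendsto_const Cin_minus_ln_limit])
    show "\<forall>\<^sub>F T in at_top. (Cin x - ln x) - (Cin T - ln T) = (LBINT t=x..T. cos t / t)"
      using eventually_ge_at_top[of x]
    proof eventually_elim
      case (elim T)
      have "(LBINT t=x..T. cos t / t) = (ln T - Cin T) - (ln x - Cin x)"
      proof (rule interval_integral_FTC_finite)
        have eq: "{min x T..max x T} = {x..T}" using elim by simp
        show "continuous_on {min x T..max x T} (\<lambda>t. cos t / t)"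
          unfolding eq using assms by (intro continuous_intros) auto
        fix t assume "min x T \<le> t" "t \<le> max x T"
        then have t: "t > 0" using elim assms by simp
        have "((\<lambda>t. ln t - Cin t) has_real_derivative 1 / t - (1 - cos t) / t) (at t)"
          using t by (intro DERIV_diff DERIV_Cin DERIV_ln_divide)
        moreover have "1 / t - (1 - cos t) / t = cos t / t" by (simp add: diff_divide_distrib)
        ultimately show "((\<lambda>t. ln t - Cin t) has_vector_derivative cos t / t) (at t within {min x T..max x T})"
          by (metis has_real_derivative_iff_has_vector_derivative has_vector_derivative_at_within)
      qed
      then show ?case by simp
    qed
  qed
  then show ?thesis
    unfolding Ci_def by (subst tendsto_Lim) auto
qed

text \<open>
  In terms of \<open>Cin\<close>, the right-hand side is \<open>sin x * (ln x +
  euler_mascheroni) - sin_harm x\<close>.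
\<close>
lemma sin_Ci_minus_cos_Si_sums:
  assumes "x > 0"
  shows "(\<lambda>j. (-1) ^ j / fact (2 * j + 1) * x ^ (2 * j + 1) *
            (ln x + euler_mascheroni - harm (2 * j + 1))) sums (sin x * Ci x - cos x * Si x)"
proof -
  have "(\<lambda>n. (sin_coeff n * x ^ n) * (ln x + euler_mascheroni) - sin_coeff n * harm n * x ^ n)
          sums (sin x * (ln x + euler_mascheroni) - sin_harm x)"
    using sin_converges[of x] by (intro sums_diff sums_mult2 sums_sin_harm) simp
  also have "sin x * (ln x + euler_mascheroni) - sin_harm x = sin x * Ci x - cos x * Si x"
    using assms by (simp add: Ci_eq sin_harm_eq algebra_simps)
  finally have "(\<lambda>n. sin_coeff n * x ^ n * (ln x + euler_mascheroni - harm n))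
          sums (sin x * Ci x - cos x * Si x)"
    by (simp add: algebra_simps)
  then have "(\<lambda>j. sin_coeff (2 * j + 1) * x ^ (2 * j + 1) * (ln x + euler_mascheroni - harm (2 * j + 1)))
          sums (sin x * Ci x - cos x * Si x)"
    by (subst sums_mono_reindex[of "\<lambda>j. 2 * j + 1"])
       (auto simp: strict_mono_def sin_coeff_def elim!: oddE)
  then show ?thesis by (simp add: sin_coeff_def)
qed

section \<open>The reciprocal Gamma function and its derivative\<close>

definition rGamma_deriv :: "real \<Rightarrow> real" where
  "rGamma_deriv = deriv rGamma"

lemma DERIV_rGamma: "(rGamma has_real_derivative rGamma_deriv x) (at x within A)"
  unfolding rGamma_deriv_def
  using has_field_derivative_rGamma[of x UNIV] DERIV_imp_deriv has_field_derivative_at_within by metis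

lemma rGamma_deriv_pos: "x > 0 \<Longrightarrow> rGamma_deriv x = - rGamma x * Digamma x"
  using has_field_derivative_rGamma_no_nonpos_int[of x UNIV] DERIV_rGamma[of x UNIV] nonpos_Ints_nonpos[of x]
  by (intro DERIV_unique[of rGamma _ x]) auto

lemma rGamma_deriv_minus_nat: "rGamma_deriv (- real n) = (-1) ^ n * fact n"
  using has_field_derivative_rGamma_nonpos_int[of n UNIV] DERIV_rGamma[of "- real n" UNIV]
  by (intro DERIV_unique) auto

lemma rGamma_recurrence: "rGamma x = x * rGamma (x + 1)" for x :: real
  by (simp add: rGamma_plus1)

lemma rGamma_deriv_recurrence: "rGamma_deriv x = rGamma (x + 1) + x * rGamma_deriv (x + 1)"
proof (rule DERIV_unique[OF DERIV_rGamma])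
  have "((\<lambda>x. x * rGamma (x + 1)) has_real_derivative rGamma (x + 1) + x * rGamma_deriv (x + 1)) (at x)"
    by (rule derivative_eq_intros DERIV_chain2[OF DERIV_rGamma] refl)+ simp
  then show "(rGamma has_real_derivative rGamma (x + 1) + x * rGamma_deriv (x + 1)) (at x)"
    by (simp add: rGamma_plus1)
qed

lemma rGamma_nat_plus1: "rGamma (real n + 1) = 1 / fact n"
  by (metis Gamma_fact rGamma_inverse_Gamma inverse_eq_divide add.commute)

lemma rGamma_minus_nat: "rGamma (- real n) = 0"
  by (simp add: rGamma_eq_zero_iff)

text \<open>
  On \<open>{1..2}\<close> both functions are bounded by compactness. The recurrences carry
  the bound one unit to the right, and each step divides by at least \<open>k + 1\<close>.
  The inhomogeneous term in the recurrence for the derivative costs the factor \<open>k +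
  1\<close> in the second bound.
\<close>
lemma rGamma_factorial_bounds:
  obtains M where "M \<ge> 0"
    "\<And>x k. x \<in> {1..2} \<Longrightarrow> \<bar>rGamma (x + real k)\<bar> \<le> M / fact k"
    "\<And>x k. x \<in> {1..2} \<Longrightarrow> \<bar>rGamma_deriv (x + real k)\<bar> \<le> M * (real k + 1) / fact k"
proof -
  have "compact ((\<lambda>x::real. rGamma x) ` {1..2})"
    by (intro compact_continuous_image continuous_intros) auto
  then obtain M1 where M1: "\<forall>x\<in>{1..2::real}. \<bar>rGamma x\<bar> \<le> M1"
    unfolding compact_eq_bounded_closed bounded_iff by auto
  have "compact ((\<lambda>x::real. - rGamma x * Digamma x) ` {1..2})"
    by (intro compact_continuous_image continuous_intros continuous_on_Polygamma)
       (auto elim!: nonpos_Ints_cases)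
  then obtain M2 where M2: "\<forall>x\<in>{1..2::real}. \<bar>rGamma x * Digamma x\<bar> \<le> M2"
    unfolding compact_eq_bounded_closed bounded_iff by auto
  define M where "M = max M1 M2"
  have M: "\<bar>rGamma x\<bar> \<le> M" "\<bar>rGamma_deriv x\<bar> \<le> M" if "x \<in> {1..2}" for x
    using bspec[OF M1 that] bspec[OF M2 that] that by (auto simp: M_def rGamma_deriv_pos abs_mult)
  have M0: "M \<ge> 0" using M(1)[of 1] by simp
  have *: "\<bar>rGamma (x + real k)\<bar> \<le> M / fact k \<and>
      \<bar>rGamma_deriv (x + real k)\<bar> \<le> M * (real k + 1) / fact k" if x: "x \<in> {1..2}" for x k
  proof (induction k)
    case 0
    show ?case using M[OF x] by simp
  next
    case (Suc k)
    let ?y = "x + real k"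
    have y: "?y \<ge> real k + 1" using x by simp
    have y1: "x + real (Suc k) = ?y + 1" by simp
    have "rGamma (?y + 1) = rGamma ?y / ?y"
      using y by (simp add: rGamma_recurrence[of ?y])
    then have "\<bar>rGamma (?y + 1)\<bar> = \<bar>rGamma ?y\<bar> / ?y" using y by simp
    also have "\<dots> \<le> (M / fact k) / (real k + 1)"
      using Suc y M0 by (intro frac_le) auto
    finally have g: "\<bar>rGamma (?y + 1)\<bar> \<le> M / fact (Suc k)" by (simp add: field_simps)
    have "rGamma_deriv (?y + 1) = (rGamma_deriv ?y - rGamma (?y + 1)) / ?y"
      using y by (simp add: rGamma_deriv_recurrence[of ?y])
    then have "\<bar>rGamma_deriv (?y + 1)\<bar> = \<bar>rGamma_deriv ?y - rGamma (?y + 1)\<bar> / ?y" using y by simp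
    also have "\<dots> \<le> (M * (real k + 1) / fact k + M / fact (Suc k)) / (real k + 1)"
      using Suc y M0 g by (intro frac_le) auto
    also have "\<dots> \<le> (M * (real k + 1) / fact k) / (real k + 1) + M / fact (Suc k)"
    proof -
      have "(M / fact (Suc k)) / (real k + 1) \<le> (M / fact (Suc k)) / 1"
        using M0 by (intro divide_left_mono) auto
      then show ?thesis by (simp add: add_divide_distrib)
    qed
    also have "\<dots> = M * (real (Suc k) + 1) / fact (Suc k)"
      by (simp add: divide_simps) (simp add: algebra_simps)
    finally show ?case using g unfolding y1 by simp
  qed
  show ?thesis by (rule that[of M]) (use * M0 in auto)
qed

text \<open>
  To the right of \<open>1\<close> the factorial bounds are more than enough; the
  recurrences then extend boundedness to the left one unit at a time.
\<close>
lemma rGamma_bounded_right_of: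
  fixes a :: real
  obtains M where "\<And>x. x \<ge> a \<Longrightarrow> \<bar>rGamma x\<bar> \<le> M" "\<And>x. x \<ge> a \<Longrightarrow> \<bar>rGamma_deriv x\<bar> \<le> M"
proof -
  have "\<exists>M\<ge>0. \<forall>x\<ge>1 - real N. \<bar>rGamma x\<bar> \<le> M \<and> \<bar>rGamma_deriv x\<bar> \<le> M" for N
  proof (induction N)
    case 0
    obtain M where M: "M \<ge> 0"
      "\<And>x k. x \<in> {1..2} \<Longrightarrow> \<bar>rGamma (x + real k)\<bar> \<le> M / fact k"
      "\<And>x k. x \<in> {1..2} \<Longrightarrow> \<bar>rGamma_deriv (x + real k)\<bar> \<le> M * (real k + 1) / fact k"
      using rGamma_factorial_bounds by blast
    have "\<bar>rGamma x\<bar> \<le> 2 * M \<and> \<bar>rGamma_deriv x\<bar> \<le> 2 * M" if "x \<ge> 1" for x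
    proof -
      define k where "k = nat \<lfloor>x - 1\<rfloor>"
      have k: "x - real k \<in> {1..2}" "x = (x - real k) + real k"
        using that by (auto simp: k_def) linarith+
      have "real k \<le> fact k" using fact_ge_self[of k] by (metis of_nat_fact of_nat_le_iff)
      then have "real k + 1 \<le> 2 * fact k" using fact_ge_1[of k, where 'a = real] by linarith
      then have "M * ((real k + 1) / fact k) \<le> M * 2" "M / fact k \<le> M / 1"
        using M(1) by (intro mult_left_mono divide_left_mono; simp add: field_simps)+
      then show ?thesis
        using M(2,3)[OF k(1), of k] k(2) M(1) by simp
    qed
    then show ?case using M(1) by (intro exI[of _ "2 * M"]) auto
  next
    case (Suc N)
    then obtain M where M: "M \<ge> 0" "\<And>x. x \<ge> 1 - real N \<Longrightarrow> \<bar>rGamma x\<bar> \<le> M"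
      "\<And>x. x \<ge> 1 - real N \<Longrightarrow> \<bar>rGamma_deriv x\<bar> \<le> M" by blast
    have "\<bar>rGamma x\<bar> \<le> M + (real N + 1) * M \<and> \<bar>rGamma_deriv x\<bar> \<le> M + (real N + 1) * M"
      if x: "x \<ge> 1 - real (Suc N)" for x
    proof (cases "x \<ge> 1 - real N")
      case True
      have "0 \<le> (real N + 1) * M" using M(1) by simp
      then show ?thesis using M(2,3)[OF True] by linarith
    next
      case False
      have b: "\<bar>rGamma (x + 1)\<bar> \<le> M" "\<bar>rGamma_deriv (x + 1)\<bar> \<le> M"
        using x by (intro M; simp)+
      have "\<bar>x * rGamma (x + 1)\<bar> \<le> (real N + 1) * M" "\<bar>x * rGamma_deriv (x + 1)\<bar> \<le> (real N + 1) * M"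
        unfolding abs_mult using x False b M(1) by (intro mult_mono; simp)+
      then show ?thesis
        using b M(1) unfolding rGamma_recurrence[of x] rGamma_deriv_recurrence[of x] by linarith
    qed
    then show ?case using M(1) by (intro exI[of _ "M + (real N + 1) * M"]) auto
  qed
  from this[of "nat \<lceil>1 - a\<rceil>"] obtain M where
    M: "\<forall>x\<ge>1 - real (nat \<lceil>1 - a\<rceil>). \<bar>rGamma x\<bar> \<le> M \<and> \<bar>rGamma_deriv x\<bar> \<le> M" by blast
  have "a \<ge> 1 - real (nat \<lceil>1 - a\<rceil>)" by linarith
  then show ?thesis using M by (intro that[of M]) force+
qed

text \<open>
  The derivatives of the terms are dominated near \<open>x\<close> by a multiple of
  \<open>\<bar>c n\<bar>\<close>, since the derivative of \<open>1 / \<Gamma>\<close> is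
  bounded on every half-line to the right.
\<close>
lemma rGamma_series_DERIV:
  fixes c :: "nat \<Rightarrow> real"
  assumes c: "summable (\<lambda>n. \<bar>c n\<bar>)"
  shows "summable (\<lambda>n. c n * rGamma (real n + x))"
    and "summable (\<lambda>n. c n * rGamma_deriv (real n + x))"
    and "((\<lambda>x. \<Sum>n. c n * rGamma (real n + x)) has_real_derivative
            (\<Sum>n. c n * rGamma_deriv (real n + x))) (at x)"
proof -
  obtain M where M: "\<And>y. y \<ge> x - 1 \<Longrightarrow> \<bar>rGamma y\<bar> \<le> M" "\<And>y. y \<ge> x - 1 \<Longrightarrow> \<bar>rGamma_deriv y\<bar> \<le> M"
    using rGamma_bounded_right_of[of "x - 1"] by blast
  have bnd: "norm (c n * rGamma (real n + y)) \<le> \<bar>c n\<bar> * M"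
      "norm (c n * rGamma_deriv (real n + y)) \<le> \<bar>c n\<bar> * M" if "y \<in> {x - 1..x + 1}" for n y
    unfolding real_norm_def abs_mult using that by (intro mult_left_mono M; simp)+
  have cM: "summable (\<lambda>n. \<bar>c n\<bar> * M)" using c by (rule summable_mult2)
  show s: "summable (\<lambda>n. c n * rGamma (real n + x))"
    using bnd(1)[of x] by (intro summable_comparison_test'[OF cM]) simp
  show "summable (\<lambda>n. c n * rGamma_deriv (real n + x))"
    using bnd(2)[of x] by (intro summable_comparison_test'[OF cM]) simp
  show "((\<lambda>x. \<Sum>n. c n * rGamma (real n + x)) has_real_derivative
            (\<Sum>n. c n * rGamma_deriv (real n + x))) (at x)"
  proof (rule has_field_derivative_series'(2)[where S = "{x - 1..x + 1}" and ?x0.0 = x])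
    show "((\<lambda>x. c n * rGamma (real n + x)) has_real_derivative c n * rGamma_deriv (real n + y))
            (at y within {x - 1..x + 1})" for n y
      by (rule derivative_eq_intros DERIV_chain2[OF DERIV_rGamma] refl)+ simp
    show "uniformly_convergent_on {x - 1..x + 1} (\<lambda>n y. \<Sum>i<n. c i * rGamma_deriv (real i + y))"
      using bnd(2) by (intro Weierstrass_m_test'[OF _ cM]) auto
  qed (use s in auto)
qed

lemma summable_linear_over_fact:
  fixes w :: real
  shows "summable (\<lambda>k. (real k + 1) / fact k * w ^ (2 * k))"
proof (rule summable_comparison_test')
  show "summable (\<lambda>k. inverse (fact k) * (2 * w\<^sup>2) ^ k)" by (rule summable_exp)
  fix k :: nat
  have "real k + 1 \<le> 2 ^ k"
    using less_exp[of k] by (metis Suc_leI of_nat_Suc of_nat_le_iff of_nat_numeral of_nat_power add.commute)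
  then have "(real k + 1) * (w\<^sup>2) ^ k \<le> 2 ^ k * (w\<^sup>2) ^ k" by (intro mult_right_mono) auto
  then show "norm ((real k + 1) / fact k * w ^ (2 * k)) \<le> inverse (fact k) * (2 * w\<^sup>2) ^ k"
    unfolding power_mult power_mult_distrib by (simp add: divide_inverse mult_ac)
qed

lemma summable_rGamma_half_powser:
  fixes w :: real
  assumes "w \<ge> 0"
  shows "summable (\<lambda>k. \<bar>rGamma (real k + 3 / 2)\<bar> * w ^ (2 * k))"
    and "summable (\<lambda>k. \<bar>rGamma_deriv (real k + 3 / 2)\<bar> * w ^ (2 * k))"
proof -
  obtain M where M: "M \<ge> 0"
    "\<And>x k. x \<in> {1..2} \<Longrightarrow> \<bar>rGamma (x + real k)\<bar> \<le> M / fact k"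
    "\<And>x k. x \<in> {1..2} \<Longrightarrow> \<bar>rGamma_deriv (x + real k)\<bar> \<le> M * (real k + 1) / fact k"
    using rGamma_factorial_bounds by blast
  have s: "summable (\<lambda>k. M * ((real k + 1) / fact k * w ^ (2 * k)))"
    by (intro summable_mult summable_linear_over_fact)
  have b: "\<bar>rGamma (real k + 3 / 2)\<bar> \<le> M * (real k + 1) / fact k"
    "\<bar>rGamma_deriv (real k + 3 / 2)\<bar> \<le> M * (real k + 1) / fact k" for k
  proof -
    have "M / fact k \<le> M * (real k + 1) / fact k"
      using M(1) by (intro divide_right_mono) (auto simp: algebra_simps)
    then show "\<bar>rGamma (real k + 3 / 2)\<bar> \<le> M * (real k + 1) / fact k"
      using M(2)[of "3 / 2" k] by (simp add: add.commute)
    show "\<bar>rGamma_deriv (real k + 3 / 2)\<bar> \<le> M * (real k + 1) / fact k"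
      using M(3)[of "3 / 2" k] by (simp add: add.commute)
  qed
  have "norm (\<bar>y\<bar> * w ^ (2 * k)) \<le> M * ((real k + 1) / fact k * w ^ (2 * k))"
    if "\<bar>y\<bar> \<le> M * (real k + 1) / fact k" for y k
    using mult_right_mono[OF that, of "w ^ (2 * k)"] assms by (simp add: abs_mult mult_ac)
  then show "summable (\<lambda>k. \<bar>rGamma (real k + 3 / 2)\<bar> * w ^ (2 * k))"
    "summable (\<lambda>k. \<bar>rGamma_deriv (real k + 3 / 2)\<bar> * w ^ (2 * k))"
    using b by (blast intro: summable_comparison_test'[OF s])+
qed

text \<open>
  A bound that is uniform in both indices: for \<open>m > k\<close> the derivative is
  evaluated at a pole of \<open>\<Gamma>\<close>, where its size is \<open>(m - 1 -
  k)!\<close>, and \<open>m!\<close> compensates that growth.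
\<close>
lemma rGamma_row_bound:
  obtains L where "L \<ge> 0"
    "\<And>k m. \<bar>rGamma (real k + 1 - real m)\<bar> / fact m \<le> L"
    "\<And>k m. \<bar>rGamma_deriv (real k + 1 - real m)\<bar> / fact m \<le> L"
proof -
  obtain M where M: "\<And>x. x \<ge> 1 \<Longrightarrow> \<bar>rGamma x\<bar> \<le> M" "\<And>x. x \<ge> 1 \<Longrightarrow> \<bar>rGamma_deriv x\<bar> \<le> M"
    using rGamma_bounded_right_of[of 1] by blast
  define L where "L = max M 1"
  have f: "y / fact m \<le> L" if "y \<le> M" "y \<ge> 0" for y and m :: nat
  proof -
    have "y / fact m \<le> y / 1" using that by (intro divide_left_mono) auto
    then show ?thesis using that by (simp add: L_def)
  qed
  have "\<bar>rGamma (real k + 1 - real m)\<bar> / fact m \<le> L \<and>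
        \<bar>rGamma_deriv (real k + 1 - real m)\<bar> / fact m \<le> L" for k m :: nat
  proof (cases "m \<le> k")
    case True
    then show ?thesis using M by (intro conjI f) auto
  next
    case False
    then have e: "real k + 1 - real m = - real (m - 1 - k)" by (simp add: of_nat_diff)
    have "fact (m - 1 - k) \<le> (fact m :: real)" by (intro fact_mono) auto
    then have "fact (m - 1 - k) / fact m \<le> (1 :: real)" by simp
    then show ?thesis
      unfolding e rGamma_minus_nat rGamma_deriv_minus_nat by (simp add: abs_mult L_def le_max_iff_disj)
  qed
  then show ?thesis by (intro that[of L]) (auto simp: L_def)
qed

lemma rGamma_duplication_nat:
  "rGamma (real k + 1) * rGamma (real k + 3 / 2) = 2 ^ (2 * k + 1) / (sqrt pi * fact (2 * k + 1))"
proof (induction k)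
  case 0
  have "rGamma (1 / 2 :: real) = 1 / sqrt pi"
    by (simp add: rGamma_inverse_Gamma Gamma_one_half_real inverse_eq_divide)
  then have "rGamma (3 / 2 :: real) = 2 / sqrt pi"
    using rGamma_recurrence[of "1 / 2"] by simp
  then show ?case using rGamma_nat_plus1[of 0] by simp
next
  case (Suc k)
  have 1: "rGamma (real (Suc k) + 1) = rGamma (real k + 1) / (real k + 1)"
    using rGamma_recurrence[of "real k + 1"] by (simp add: add_ac)
  have 2: "rGamma (real (Suc k) + 3 / 2) = rGamma (real k + 3 / 2) / (real k + 3 / 2)"
    using rGamma_recurrence[of "real k + 3 / 2"] by (simp add: add_ac)
  have "rGamma (real (Suc k) + 1) * rGamma (real (Suc k) + 3 / 2)
      = (rGamma (real k + 1) * rGamma (real k + 3 / 2)) / ((real k + 1) * (real k + 3 / 2))"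
    unfolding 1 2 by simp
  also have "\<dots> = 2 ^ (2 * Suc k + 1) / (sqrt pi * fact (2 * Suc k + 1))"
    unfolding Suc by (simp add: divide_simps) (simp add: algebra_simps)
  finally show ?case .
qed

lemma Digamma_duplication_nat:
  "Digamma (real k + 1) + Digamma (real k + 3 / 2)
     = 2 * (harm (2 * k + 1) - euler_mascheroni - ln 2)"
proof -
  have 1: "Digamma (real k + 1) = harm k - euler_mascheroni"
    using Digamma_of_nat[of k, where 'a = real] by (simp add: add.commute)
  have "Digamma (real k + 3 / 2) = (\<Sum>j<Suc k. 2 / (2 * real j + 1)) - euler_mascheroni - 2 * ln 2"
    using Digamma_half_integer[of "Suc k", where 'a = real] by (simp add: algebra_simps)
  then have 2: "Digamma (real k + 3 / 2) = 2 * harm (2 * Suc k) - harm (Suc k) - euler_mascheroni - 2 * ln 2"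
    by (simp only: sum_odd_reciprocals)
  have "2 * harm (2 * Suc k) - harm (Suc k) = 2 * harm (2 * k + 1) - (harm k :: real)"
  proof -
    have "inverse (2 * real k + 2) = inverse (real k + 1) / 2" by (simp add: field_simps)
    moreover have "harm (2 * Suc k) = harm (2 * k + 1) + inverse (2 * real k + 2)"
      "harm (Suc k) = harm k + inverse (real k + 1)" by (simp_all add: harm_Suc add_ac)
    ultimately show ?thesis by simp
  qed
  with 1 2 show ?thesis by simp
qed

section \<open>Binomial series of reciprocal Gamma values\<close>

text \<open>
  An algebraic step from \<open>k\<close> to \<open>k + 1\<close> that serves both \<open>1
  / \<Gamma>\<close> (with \<open>e = 0\<close>) and its derivative (with \<open>e = 1 /
  \<Gamma>\<close>). Expanding \<open>f (k + 1 - m)\<close> by the recurrence gives the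
  sought terms with the weight \<open>k + 1 - m\<close>. The part with weight
  \<open>m\<close> is, after a shift of the index, \<open>- c\<close> times the series at
  \<open>k\<close>.
\<close>
lemma binomial_sums_step:
  fixes e f :: "real \<Rightarrow> real"
  assumes rec: "\<And>x. f x = e (x + 1) + x * f (x + 1)"
    and A: "(\<lambda>m. (- c) ^ m / fact m * f (real k + 1 - real m)) sums A"
    and E: "(\<lambda>m. (- c) ^ m / fact m * e (real k + 2 - real m)) sums E"
  shows "(\<lambda>m. (- c) ^ m / fact m * f (real k + 2 - real m)) sums (((1 - c) * A - E) / (real k + 1))"
proof -
  let ?t = "\<lambda>m. (- c) ^ m / fact m * f (real k + 2 - real m)"
  have "(\<lambda>m. real (Suc m) * ?t (Suc m)) sums (- c * A)"
  proof -
    have eq: "real (Suc m) * ?t (Suc m) = - c * ((- c) ^ m / fact m * f (real k + 1 - real m))" for m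
    proof -
      have "real k + 2 - real (Suc m) = real k + 1 - real m" by simp
      then show ?thesis by (simp only:) (simp add: divide_simps del: of_nat_Suc)
    qed
    show ?thesis unfolding eq by (rule sums_mult[OF A])
  qed
  then have M: "(\<lambda>m. real m * ?t m) sums (- c * A)"
    using sums_Suc_iff[of "\<lambda>m. real m * ?t m" "- c * A"] by simp
  have split: "(- c) ^ m / fact m * f (real k + 1 - real m) - (- c) ^ m / fact m * e (real k + 2 - real m)
        + real m * ?t m = (real k + 1) * ?t m" for m
  proof -
    define q where "q = (- c) ^ m / fact m"
    have "f (real k + 1 - real m) - e (real k + 2 - real m) + real m * f (real k + 2 - real m)
        = (real k + 1) * f (real k + 2 - real m)"
      using rec[of "real k + 1 - real m"] by (simp add: algebra_simps)
    then have "q * (f (real k + 1 - real m) - e (real k + 2 - real m) + real m * f (real k + 2 - real m))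
        = q * ((real k + 1) * f (real k + 2 - real m))" by simp
    then show ?thesis unfolding q_def[symmetric] by (simp only: right_diff_distrib distrib_left mult_ac)
  qed
  have "(\<lambda>m. (real k + 1) * ?t m) sums (A - E + - c * A)"
    using sums_add[OF sums_diff[OF A E] M] unfolding split .
  moreover have "A - E + - c * A = (1 - c) * A - E" by (simp add: algebra_simps)
  ultimately have "(\<lambda>m. (real k + 1) * ?t m / (real k + 1)) sums (((1 - c) * A - E) / (real k + 1))"
    by (metis sums_divide)
  moreover have "real k + 1 \<noteq> 0" by linarith
  ultimately show ?thesis by simp
qed

text \<open>
  This is the binomial theorem for \<open>(1 - c) ^ k\<close>, divided by \<open>k!\<close>:
  the reciprocal Gamma function vanishes in the terms with \<open>m > k\<close>.
\<close>
lemma binomial_rGamma_sums: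
  "(\<lambda>m. (- c) ^ m / fact m * rGamma (real k + 1 - real m)) sums ((1 - c) ^ k * rGamma (real k + 1))"
proof (induction k)
  case 0
  have "rGamma (1 - real (Suc m)) = 0" for m using rGamma_minus_nat[of m] by simp
  then have "(\<lambda>m. (- c) ^ Suc m / fact (Suc m) * rGamma (1 - real (Suc m))) sums 0"
    by (simp del: fact_Suc of_nat_Suc)
  then show ?case
    using sums_Suc_iff[of "\<lambda>m. (- c) ^ m / fact m * rGamma (1 - real m)" 0] by simp
next
  case (Suc k)
  have "(\<lambda>m. (- c) ^ m / fact m * rGamma (real k + 2 - real m)) sums
      (((1 - c) * ((1 - c) ^ k * rGamma (real k + 1)) - 0) / (real k + 1))"
    by (rule binomial_sums_step[where e = "\<lambda>_. 0", OF _ Suc]) (simp_all add: rGamma_plus1)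
  moreover have "rGamma (real k + 1) / (real k + 1) = rGamma (real k + 2)"
    using rGamma_recurrence[of "real k + 1"] by (simp add: add_ac)
  then have "((1 - c) * ((1 - c) ^ k * rGamma (real k + 1)) - 0) / (real k + 1)
      = (1 - c) ^ Suc k * rGamma (real k + 2)"
    by (metis diff_zero mult.assoc power_Suc times_divide_eq_right)
  ultimately show ?case by (simp add: add_ac)
qed

text \<open>
  This is the derivative in \<open>x\<close> of the binomial series \<open>\<Sum>m. (-c)^m /
  m! * rGamma (x - m) = (1 - c) powr (x - 1) * rGamma x\<close> at \<open>x = k + 1\<close>.
  For \<open>k = 0\<close> it is the logarithm series: at the poles of
  \<open>\<Gamma>\<close> the derivative of \<open>1 / \<Gamma>\<close> is a signed
  factorial, which leaves \<open>- c ^ m / m\<close>.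
\<close>
lemma binomial_rGamma_deriv_sums:
  assumes c: "0 < c" "c < 1"
  shows "(\<lambda>m. (- c) ^ m / fact m * rGamma_deriv (real k + 1 - real m)) sums
           ((1 - c) ^ k * (ln (1 - c) * rGamma (real k + 1) + rGamma_deriv (real k + 1)))"
proof (induction k)
  case 0
  have eq: "(- c) ^ Suc m / fact (Suc m) * rGamma_deriv (1 - real (Suc m)) = - (c ^ Suc m) / real (Suc m)" for m
  proof -
    have "(- c) ^ Suc m * (- 1) ^ m = - (c ^ Suc m)" by (cases "even m") auto
    then have "(- c) ^ Suc m / fact (Suc m) * ((- 1) ^ m * fact m) = - (c ^ Suc m) / real (Suc m)"
      by (simp only: fact_Suc) (simp add: divide_simps del: of_nat_Suc power_Suc)
    then show ?thesis using rGamma_deriv_minus_nat[of m] by simp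
  qed
  have "(\<lambda>n. - (c ^ n) / real n) sums ln (1 - c)"
    using ln_series'[of "- c"] c by simp
  then have "(\<lambda>m. - (c ^ Suc m) / real (Suc m)) sums ln (1 - c)"
    using sums_Suc_iff[of "\<lambda>n. - (c ^ n) / real n" "ln (1 - c)"] by simp
  then have "(\<lambda>m. (- c) ^ Suc m / fact (Suc m) * rGamma_deriv (1 - real (Suc m))) sums ln (1 - c)"
    unfolding eq .
  then show ?case
    using sums_Suc_iff[of "\<lambda>m. (- c) ^ m / fact m * rGamma_deriv (1 - real m)" "ln (1 - c)"]
      rGamma_nat_plus1[of 0] by simp
next
  case (Suc k)
  let ?A = "(1 - c) ^ k * (ln (1 - c) * rGamma (real k + 1) + rGamma_deriv (real k + 1))"
  have "(\<lambda>m. (- c) ^ m / fact m * rGamma (real k + 2 - real m)) sums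
      ((1 - c) ^ Suc k * rGamma (real k + 2))"
    using binomial_rGamma_sums[of c "Suc k"] by (simp add: add_ac)
  then have "(\<lambda>m. (- c) ^ m / fact m * rGamma_deriv (real k + 2 - real m)) sums
      (((1 - c) * ?A - (1 - c) ^ Suc k * rGamma (real k + 2)) / (real k + 1))"
    by (rule binomial_sums_step[where e = rGamma, OF rGamma_deriv_recurrence Suc])
  moreover have g: "rGamma (real k + 1) = (real k + 1) * rGamma (real k + 2)"
    "rGamma_deriv (real k + 1) = rGamma (real k + 2) + (real k + 1) * rGamma_deriv (real k + 2)"
    using rGamma_recurrence[of "real k + 1"] rGamma_deriv_recurrence[of "real k + 1"] by (simp_all add: add_ac)
  have "((1 - c) * ?A - (1 - c) ^ Suc k * rGamma (real k + 2)) =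
      (real k + 1) * ((1 - c) ^ Suc k * (ln (1 - c) * rGamma (real k + 2) + rGamma_deriv (real k + 2)))"
    unfolding g power_Suc by (simp add: algebra_simps)
  then have "((1 - c) * ?A - (1 - c) ^ Suc k * rGamma (real k + 2)) / (real k + 1)
      = (1 - c) ^ Suc k * (ln (1 - c) * rGamma (real k + 2) + rGamma_deriv (real k + 2))"
    by simp
  ultimately show ?case by (simp add: add_ac)
qed

section \<open>Derivatives of Bessel and Struve functions in the order\<close>

text \<open>
  The common shape of the Bessel (\<open>r = 0\<close>, \<open>s = 1\<close>) and Struve
  (\<open>r = 1\<close>, \<open>s = 3/2\<close>) series as functions of the order. The
  factor \<open>w powr (\<alpha> + r)\<close> does not depend on \<open>n\<close>; what
  remains is a series of shifted reciprocal Gamma functions with absolutely summable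
  coefficients.
\<close>
lemma sums_deriv_order_series:
  fixes a :: "nat \<Rightarrow> real"
  assumes w: "w > 0" and a: "summable (\<lambda>n. \<bar>a n\<bar> * w ^ (2 * n))"
  shows "(\<lambda>n. a n * w powr (2 * real n + \<alpha> + r) *
             (rGamma_deriv (real n + \<alpha> + s) + ln w * rGamma (real n + \<alpha> + s)))
         sums deriv (\<lambda>\<alpha>. \<Sum>n. a n * rGamma (real n + \<alpha> + s) * w powr (2 * real n + \<alpha> + r)) \<alpha>"
proof -
  define c where "c n = a n * w ^ (2 * n)" for n
  have c: "summable (\<lambda>n. \<bar>c n\<bar>)" using a w by (simp add: c_def abs_mult)
  have pw: "w powr (2 * real n + x + r) = w ^ (2 * n) * w powr (x + r)" for n x
  proof -
    have "2 * real n + x + r = real (2 * n) + (x + r)" by simp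
    then show ?thesis using w by (metis powr_add powr_realpow)
  qed
  note S = rGamma_series_DERIV[OF c]
  have t: "a n * rGamma (real n + x + s) * w powr (2 * real n + x + r)
      = w powr (x + r) * (c n * rGamma (real n + (x + s)))" for n x
    unfolding pw c_def by (simp add: algebra_simps)
  have eq: "(\<lambda>x. \<Sum>n. a n * rGamma (real n + x + s) * w powr (2 * real n + x + r))
          = (\<lambda>x. w powr (x + r) * (\<Sum>n. c n * rGamma (real n + (x + s))))"
  proof
    fix x
    show "(\<Sum>n. a n * rGamma (real n + x + s) * w powr (2 * real n + x + r))
          = w powr (x + r) * (\<Sum>n. c n * rGamma (real n + (x + s)))"
      unfolding t by (rule suminf_mult[OF S(1)])
  qed
  have "((\<lambda>x. w powr (x + r)) has_real_derivative w powr (\<alpha> + r) * ln w) (at \<alpha>)"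
    using w by (auto intro!: derivative_eq_intros)
  moreover have "((\<lambda>x. \<Sum>n. c n * rGamma (real n + (x + s))) has_real_derivative
      (\<Sum>n. c n * rGamma_deriv (real n + (\<alpha> + s))) * 1) (at \<alpha>)"
    by (rule DERIV_chain2[OF S(3)]) (auto intro!: derivative_eq_intros)
  ultimately have "((\<lambda>x. w powr (x + r) * (\<Sum>n. c n * rGamma (real n + (x + s)))) has_real_derivative
      w powr (\<alpha> + r) * ((\<Sum>n. c n * rGamma_deriv (real n + (\<alpha> + s)))
         + ln w * (\<Sum>n. c n * rGamma (real n + (\<alpha> + s))))) (at \<alpha>)"
    by (rule DERIV_cong[OF DERIV_mult]) (simp add: algebra_simps)
  then have "deriv (\<lambda>x. \<Sum>n. a n * rGamma (real n + x + s) * w powr (2 * real n + x + r)) \<alpha>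
     = w powr (\<alpha> + r) * ((\<Sum>n. c n * rGamma_deriv (real n + (\<alpha> + s)))
         + ln w * (\<Sum>n. c n * rGamma (real n + (\<alpha> + s))))"
    unfolding eq by (rule DERIV_imp_deriv)
  moreover have "(\<lambda>n. w powr (\<alpha> + r) * (c n * rGamma_deriv (real n + (\<alpha> + s))
         + ln w * (c n * rGamma (real n + (\<alpha> + s))))) sums
     (w powr (\<alpha> + r) * ((\<Sum>n. c n * rGamma_deriv (real n + (\<alpha> + s)))
         + ln w * (\<Sum>n. c n * rGamma (real n + (\<alpha> + s)))))"
    by (intro sums_mult sums_add summable_sums S)
  moreover have "a n * w powr (2 * real n + \<alpha> + r) *
             (rGamma_deriv (real n + \<alpha> + s) + ln w * rGamma (real n + \<alpha> + s))
      = w powr (\<alpha> + r) * (c n * rGamma_deriv (real n + (\<alpha> + s))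
         + ln w * (c n * rGamma (real n + (\<alpha> + s))))" for n
    unfolding pw c_def by (simp add: algebra_simps)
  ultimately show ?thesis by simp
qed

text \<open>
  The series is indexed by \<open>k = n + m\<close>, where \<open>n\<close> is the index in
  the definition of the Bessel function, and \<open>rGamma (k + 1 - m)\<close> stands for
  \<open>1 / n!\<close>. The additional terms \<open>k < m\<close> vanish. In this form the
  terms match those of the Struve series.
\<close>
lemma Bessel_J_deriv_half_sums:
  assumes "z > 0"
  shows "(\<lambda>k. (-1) ^ (k + m) * (z / 2) powr (2 * real k - real m + 1 / 2) * rGamma (real k + 1 - real m) *
            (rGamma_deriv (real k + 3 / 2) + ln (z / 2) * rGamma (real k + 3 / 2)))
         sums Bessel_J_deriv (real m + 1 / 2) z"
proof -
  define w where "w = z / 2"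
  let ?f = "\<lambda>k. (-1) ^ (k + m) * w powr (2 * real k - real m + 1 / 2) * rGamma (real k + 1 - real m) *
            (rGamma_deriv (real k + 3 / 2) + ln w * rGamma (real k + 3 / 2))"
  have w: "w > 0" using assms by (simp add: w_def)
  have "summable (\<lambda>n. inverse (fact n) * (w\<^sup>2) ^ n)" by (rule summable_exp)
  then have s: "summable (\<lambda>n. \<bar>(-1) ^ n / fact n\<bar> * w ^ (2 * n))"
    by (simp add: power_mult divide_inverse abs_mult)
  have "(\<lambda>n. (-1) ^ n / fact n * w powr (2 * real n + (real m + 1 / 2) + 0) *
             (rGamma_deriv (real n + (real m + 1 / 2) + 1) + ln w * rGamma (real n + (real m + 1 / 2) + 1)))
         sums Bessel_J_deriv (real m + 1 / 2) z"
    using sums_deriv_order_series[OF w s, of "real m + 1 / 2" 0 1]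
    unfolding Bessel_J_deriv_def Bessel_J_def w_def by simp
  moreover have "(-1) ^ n / fact n * w powr (2 * real n + (real m + 1 / 2) + 0) *
             (rGamma_deriv (real n + (real m + 1 / 2) + 1) + ln w * rGamma (real n + (real m + 1 / 2) + 1))
      = ?f (n + m)" for n
  proof -
    have "real (n + m) + 1 - real m = real n + 1" "real n + (real m + 1 / 2) + 1 = real (n + m) + 3 / 2"
      "2 * real n + (real m + 1 / 2) + 0 = 2 * real (n + m) - real m + 1 / 2" by simp_all
    moreover have "(-1 :: real) ^ (n + m + m) = (-1) ^ n" by (simp add: power_add flip: power_mult_distrib)
    ultimately show ?thesis by (simp only: rGamma_nat_plus1) simp
  qed
  ultimately have "(\<lambda>n. ?f (n + m)) sums Bessel_J_deriv (real m + 1 / 2) z" by simp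
  moreover have "?f k = 0" if "k < m" for k
  proof -
    have "real k + 1 - real m = - real (m - 1 - k)" using that by (simp add: of_nat_diff)
    then show ?thesis by (simp only: rGamma_minus_nat mult_zero_right mult_zero_left)
  qed
  ultimately show ?thesis unfolding w_def using sums_zero_iff_shift[of m ?f] w_def by simp
qed

lemma Struve_H_deriv_half_sums:
  assumes "z > 0"
  shows "(\<lambda>k. (-1) ^ k * (z / 2) powr (2 * real k - real m + 1 / 2) * rGamma (real k + 3 / 2) *
            (rGamma_deriv (real k + 1 - real m) + ln (z / 2) * rGamma (real k + 1 - real m)))
         sums Struve_H_deriv (- (real m + 1 / 2)) z"
proof -
  define w where "w = z / 2"
  have w: "w > 0" using assms by (simp add: w_def)
  have s: "summable (\<lambda>n. \<bar>(-1) ^ n * rGamma (real n + 3 / 2)\<bar> * w ^ (2 * n))"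
    using summable_rGamma_half_powser(1)[of w] w by (simp add: abs_mult)
  have idx: "2 * real k + - (real m + 1 / 2) + 1 = 2 * real k - real m + 1 / 2"
    "real k + - (real m + 1 / 2) + 3 / 2 = real k + 1 - real m" for k by simp_all
  have "(\<lambda>k. (-1) ^ k * rGamma (real k + 3 / 2) * w powr (2 * real k - real m + 1 / 2) *
            (rGamma_deriv (real k + 1 - real m) + ln w * rGamma (real k + 1 - real m)))
         sums Struve_H_deriv (- (real m + 1 / 2)) z"
    using sums_deriv_order_series[OF w s, of "- (real m + 1 / 2)" 1 "3 / 2"]
    unfolding idx Struve_H_deriv_def Struve_H_def w_def .
  then show ?thesis unfolding w_def by (simp only: mult_ac)
qed

text \<open>
  The terms with and without the logarithm combine to what the product rule gives for
  \<open>rGamma (k + 1 - m + \<epsilon>) * rGamma (k + 3/2 + \<epsilon>) * (z / 2) powr (2 *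
  \<epsilon>)\<close>.
\<close>
lemma Bessel_Struve_deriv_sums:
  assumes "z > 0"
  shows "(\<lambda>k. (-1) ^ (k + m) * (z / 2) powr (2 * real k - real m + 1 / 2) *
            (rGamma (real k + 1 - real m) *
                 (rGamma_deriv (real k + 3 / 2) + 2 * ln (z / 2) * rGamma (real k + 3 / 2))
             + rGamma_deriv (real k + 1 - real m) * rGamma (real k + 3 / 2)))
         sums (Bessel_J_deriv (real m + 1 / 2) z + (-1) ^ m * Struve_H_deriv (- (real m + 1 / 2)) z)"
  using sums_add[OF Bessel_J_deriv_half_sums[OF assms, of m]
      sums_mult[OF Struve_H_deriv_half_sums[OF assms, of m], of "(-1) ^ m"]]
  by (simp add: power_add algebra_simps)

section \<open>Summation over the orders\<close>

text \<open>
  Fubini for iterated series: the product bound makes the family summable over all pairs.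
\<close>
lemma sums_swap:
  fixes f :: "nat \<Rightarrow> nat \<Rightarrow> real"
  assumes bound: "\<And>m k. \<bar>f m k\<bar> \<le> u m * v k" and u: "summable u" and v: "summable v"
    and nonneg: "\<And>m. u m \<ge> 0" "\<And>k. v k \<ge> 0"
    and rows: "\<And>m. (\<lambda>k. f m k) sums r m" and cols: "\<And>k. (\<lambda>m. f m k) sums s k"
    and total: "s sums S"
  shows "r sums S"
proof -
  have hs: "(h has_sum a) UNIV" if "\<And>n. \<bar>h n\<bar> \<le> d * e n" "summable e" "h sums a"
    for h e :: "nat \<Rightarrow> real" and a d
    using that by (intro norm_summable_imp_has_sum summable_comparison_test'[OF summable_mult[OF that(2), of d]]) auto
  have rows': "((\<lambda>k. f m k) has_sum r m) UNIV" for m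
    by (rule hs[OF _ v rows]) (rule bound)
  have cols': "((\<lambda>m. f m k) has_sum s k) UNIV" for k
    by (rule hs[OF _ u cols, of _ "v k"]) (use bound in \<open>simp add: mult.commute\<close>)
  have "(\<lambda>(m, k). f m k) summable_on UNIV \<times> UNIV"
  proof (rule abs_summable_summable, rule summable_on_comparison_test)
    show "(\<lambda>(m, k). u m * v k) summable_on UNIV \<times> UNIV"
    proof (rule summable_on_SigmaI)
      show "((\<lambda>k. (\<lambda>(m, k). u m * v k) (m, k)) has_sum u m * suminf v) UNIV" for m
        using hs[of "\<lambda>k. u m * v k" "u m" v] nonneg v by (simp add: abs_mult sums_mult summable_sums)
      show "(\<lambda>m. u m * suminf v) summable_on UNIV"
        using u nonneg suminf_nonneg[OF v] by (subst summable_on_UNIV_nonneg_real_iff) (auto intro: summable_mult2)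
    qed (use nonneg in auto)
  qed (use bound in auto)
  then obtain S' where S': "((\<lambda>(m, k). f m k) has_sum S') (UNIV \<times> UNIV)"
    by (auto simp: summable_on_def)
  have 1: "(r has_sum S') UNIV" using S' by (rule has_sum_SigmaD) (use rows' in auto)
  have "((\<lambda>(k, m). f m k) has_sum S') (UNIV \<times> UNIV)"
    using S' by (subst has_sum_swap) simp
  then have 2: "(s has_sum S') UNIV" by (rule has_sum_SigmaD) (use cols' in auto)
  have "S' = S" using has_sum_imp_sums[OF 2] total sums_unique2 by blast
  then show ?thesis using has_sum_imp_sums[OF 1] by simp
qed

text \<open>
  By the duplication formulas, the product of the two reciprocal Gamma values is \<open>1 /
  (2 k + 1)!\<close> up to elementary factors and the two logarithmic derivatives add up to
  a harmonic number.
\<close>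
lemma half_integer_rGamma_product_sums:
  assumes "x > 0"
  shows "(\<lambda>k. (-1) ^ k * (x / 2) ^ (2 * k) *
            (rGamma (real k + 1) * (rGamma_deriv (real k + 3 / 2) + 2 * ln (x / 2) * rGamma (real k + 3 / 2))
              + rGamma_deriv (real k + 1) * rGamma (real k + 3 / 2)))
         sums (4 / (sqrt pi * x) * (sin x * Ci x - cos x * Si x))"
proof -
  have eq: "(-1) ^ k * (x / 2) ^ (2 * k) *
            (rGamma (real k + 1) * (rGamma_deriv (real k + 3 / 2) + 2 * ln (x / 2) * rGamma (real k + 3 / 2))
              + rGamma_deriv (real k + 1) * rGamma (real k + 3 / 2))
      = 4 / (sqrt pi * x) * ((-1) ^ k / fact (2 * k + 1) * x ^ (2 * k + 1) *
            (ln x + euler_mascheroni - harm (2 * k + 1)))" for k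
  proof -
    have "rGamma (real k + 1) * (rGamma_deriv (real k + 3 / 2) + 2 * ln (x / 2) * rGamma (real k + 3 / 2))
              + rGamma_deriv (real k + 1) * rGamma (real k + 3 / 2)
        = (rGamma (real k + 1) * rGamma (real k + 3 / 2)) *
            (2 * ln (x / 2) - (Digamma (real k + 1) + Digamma (real k + 3 / 2)))"
      by (simp add: rGamma_deriv_pos algebra_simps)
    also have "\<dots> = 2 ^ (2 * k + 1) / (sqrt pi * fact (2 * k + 1)) *
         (2 * (ln x + euler_mascheroni - harm (2 * k + 1)))"
      unfolding rGamma_duplication_nat Digamma_duplication_nat using assms by (simp add: ln_div)
    finally have E: "rGamma (real k + 1) * (rGamma_deriv (real k + 3 / 2) + 2 * ln (x / 2) * rGamma (real k + 3 / 2))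
              + rGamma_deriv (real k + 1) * rGamma (real k + 3 / 2)
        = 2 ^ (2 * k + 1) / (sqrt pi * fact (2 * k + 1)) * (2 * (ln x + euler_mascheroni - harm (2 * k + 1)))" .
    have "(-1) ^ k * (x / 2) ^ (2 * k) * (2 ^ (2 * k + 1) / (sqrt pi * F) * (2 * Y))
        = 4 / (sqrt pi * x) * ((-1) ^ k / F * x ^ (2 * k + 1) * Y)" for F Y :: real
    proof -
      have "(-1) ^ k * (x / 2) ^ (2 * k) * (2 ^ (2 * k + 1) / (sqrt pi * F) * (2 * Y))
          = ((x / 2) ^ (2 * k) * 2 ^ (2 * k + 1)) * ((-1) ^ k * 2 * Y / (sqrt pi * F))"
        by simp
      also have "(x / 2) ^ (2 * k) * 2 ^ (2 * k + 1) = 2 * x ^ (2 * k)"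
        by (simp add: power_divide)
      finally show ?thesis using assms by simp
    qed
    then show ?thesis unfolding E .
  qed
  show ?thesis unfolding eq by (rule sums_mult[OF sin_Ci_minus_cos_Si_sums[OF assms]])
qed

text \<open>
  In \<open>f m k\<close> the index \<open>m\<close> is the one of the order and
  \<open>k\<close> the one of the joint Bessel and Struve series. The sum over
  \<open>m\<close> is evaluated by the two binomial series, and the result is the single
  series at \<open>b * d\<close>.
\<close>
lemma Bessel_Struve_deriv_generating_sum:
  assumes b: "b > 0" and c: "0 < c" "c < 1"
  defines "d \<equiv> sqrt (1 - c)"
  shows "(\<lambda>m. (b * c) ^ Suc m / (fact m * 2 ^ Suc m) *
            (Bessel_J_deriv (real m + 1 / 2) b + (-1) ^ m * Struve_H_deriv (- (real m + 1 / 2)) b))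
         sums (2 * c / d * sqrt (b / (2 * pi)) * (sin (b * d) * Ci (b * d) - cos (b * d) * Si (b * d)))"
proof -
  define w where "w = b / 2"
  have w: "w > 0" using b by (simp add: w_def)
  have d: "d > 0" "d ^ 2 = 1 - c" using c by (simp_all add: d_def)
  define v where "v k = c * w powr (3 / 2) * (-1) ^ k * w ^ (2 * k)" for k :: nat
  define p where "p k = rGamma_deriv (real k + 3 / 2) + 2 * ln w * rGamma (real k + 3 / 2)" for k :: nat
  define q where "q k = rGamma (real k + 3 / 2 :: real)" for k :: nat
  define A where "A m k = (- c) ^ m / fact m * rGamma (real k + 1 - real m)" for m k :: nat
  define B where "B m k = (- c) ^ m / fact m * rGamma_deriv (real k + 1 - real m)" for m k :: nat
  define f where "f m k = v k * (A m k * p k + B m k * q k)" for m k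
  obtain L where L: "L \<ge> 0"
    "\<And>k m. \<bar>rGamma (real k + 1 - real m)\<bar> / fact m \<le> L"
    "\<And>k m. \<bar>rGamma_deriv (real k + 1 - real m)\<bar> / fact m \<le> L"
    using rGamma_row_bound by blast
  let ?u = "\<lambda>m. L * c ^ m" and ?V = "\<lambda>k. \<bar>v k\<bar> * (\<bar>p k\<bar> + \<bar>q k\<bar>)"
  show ?thesis
  proof (rule sums_swap[where f = f and u = ?u and v = ?V])
    fix m k
    have "\<bar>A m k\<bar> = c ^ m * (\<bar>rGamma (real k + 1 - real m)\<bar> / fact m)"
      "\<bar>B m k\<bar> = c ^ m * (\<bar>rGamma_deriv (real k + 1 - real m)\<bar> / fact m)"
      using c by (simp_all add: A_def B_def abs_mult power_abs)
    then have AB: "\<bar>A m k\<bar> \<le> ?u m" "\<bar>B m k\<bar> \<le> ?u m"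
      using mult_left_mono[OF L(2), of "c ^ m" k m] mult_left_mono[OF L(3), of "c ^ m" k m] c
      by (simp_all add: mult.commute)
    have "\<bar>A m k * p k + B m k * q k\<bar> \<le> \<bar>A m k\<bar> * \<bar>p k\<bar> + \<bar>B m k\<bar> * \<bar>q k\<bar>"
      using abs_triangle_ineq[of "A m k * p k" "B m k * q k"] by (simp add: abs_mult)
    also have "\<dots> \<le> ?u m * \<bar>p k\<bar> + ?u m * \<bar>q k\<bar>"
      using AB by (intro add_mono mult_right_mono) auto
    finally have "\<bar>v k\<bar> * \<bar>A m k * p k + B m k * q k\<bar> \<le> \<bar>v k\<bar> * (?u m * \<bar>p k\<bar> + ?u m * \<bar>q k\<bar>)"
      by (intro mult_left_mono) auto
    also have "\<dots> = ?u m * ?V k" by (simp add: algebra_simps)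
    finally show "\<bar>f m k\<bar> \<le> ?u m * ?V k" by (simp only: f_def abs_mult)
  next
    show "summable ?u" using c by (intro summable_mult summable_geometric) auto
  next
    have "summable (\<lambda>k. (c * w powr (3 / 2)) * (\<bar>rGamma_deriv (real k + 3 / 2)\<bar> * w ^ (2 * k)
        + (2 * \<bar>ln w\<bar> + 1) * (\<bar>rGamma (real k + 3 / 2)\<bar> * w ^ (2 * k))))"
      using w by (intro summable_mult summable_add summable_rGamma_half_powser) auto
    then show "summable ?V"
    proof (rule summable_comparison_test')
      fix k :: nat
      have "\<bar>p k\<bar> + \<bar>q k\<bar> \<le> \<bar>rGamma_deriv (real k + 3 / 2)\<bar> + (2 * \<bar>ln w\<bar> + 1) * \<bar>rGamma (real k + 3 / 2)\<bar>"
        using abs_triangle_ineq[of "rGamma_deriv (real k + 3 / 2)" "2 * ln w * rGamma (real k + 3 / 2)"]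
        by (simp add: p_def q_def abs_mult algebra_simps)
      then have "?V k \<le> \<bar>v k\<bar> * (\<bar>rGamma_deriv (real k + 3 / 2)\<bar> + (2 * \<bar>ln w\<bar> + 1) * \<bar>rGamma (real k + 3 / 2)\<bar>)"
        by (intro mult_left_mono) auto
      moreover have "\<bar>v k\<bar> = c * w powr (3 / 2) * w ^ (2 * k)"
        using c w by (simp add: v_def abs_mult)
      moreover have "norm (?V k) = ?V k" by simp
      ultimately show "norm (?V k) \<le> (c * w powr (3 / 2)) * (\<bar>rGamma_deriv (real k + 3 / 2)\<bar> * w ^ (2 * k)
        + (2 * \<bar>ln w\<bar> + 1) * (\<bar>rGamma (real k + 3 / 2)\<bar> * w ^ (2 * k)))"
        by (simp add: algebra_simps)
    qed
  next
    fix m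
    have bc: "(b * c) ^ Suc m / (fact m * 2 ^ Suc m) = (w * c) ^ Suc m / fact m"
      by (simp add: w_def power_mult_distrib power_divide field_simps)
    have "(w * c) ^ Suc m / fact m * ((-1) ^ (k + m) * w powr (2 * real k - real m + 1 / 2) * y)
        = v k * ((- c) ^ m / fact m * y)" for k y
    proof -
      have "w ^ Suc m * w powr (2 * real k - real m + 1 / 2) = w powr (3 / 2) * w ^ (2 * k)"
        using w by (simp add: powr_realpow[symmetric] powr_add[symmetric] del: power_Suc of_nat_Suc)
           (simp add: algebra_simps)
      then have "(w * c) ^ Suc m / fact m * ((-1) ^ (k + m) * w powr (2 * real k - real m + 1 / 2) * y)
        = (w powr (3 / 2) * w ^ (2 * k)) * (c ^ Suc m / fact m * (-1) ^ (k + m) * y)"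
        by (simp only: power_mult_distrib) (simp add: algebra_simps)
      then show ?thesis
        unfolding v_def power_minus[of c m] by (simp add: power_add algebra_simps)
    qed
    then have eq: "(w * c) ^ Suc m / fact m * ((-1) ^ (k + m) * w powr (2 * real k - real m + 1 / 2) *
            (rGamma (real k + 1 - real m) * p k + rGamma_deriv (real k + 1 - real m) * q k)) = f m k" for k
      by (simp only: f_def A_def B_def distrib_left mult.assoc)
    show "f m sums ((b * c) ^ Suc m / (fact m * 2 ^ Suc m) *
            (Bessel_J_deriv (real m + 1 / 2) b + (-1) ^ m * Struve_H_deriv (- (real m + 1 / 2)) b))"
      using sums_mult[OF Bessel_Struve_deriv_sums[OF b, of m], of "(w * c) ^ Suc m / fact m"]
      unfolding bc w_def[symmetric] eq[unfolded p_def q_def] .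
  next
    fix k
    have "(\<lambda>m. v k * (A m k * p k + B m k * q k)) sums
        (v k * ((1 - c) ^ k * rGamma (real k + 1) * p k
          + (1 - c) ^ k * (ln (1 - c) * rGamma (real k + 1) + rGamma_deriv (real k + 1)) * q k))"
      unfolding A_def B_def
      by (intro sums_mult sums_add sums_mult2 binomial_rGamma_sums binomial_rGamma_deriv_sums c)
    then show "(\<lambda>m. f m k) sums (v k * ((1 - c) ^ k * rGamma (real k + 1) * p k
          + (1 - c) ^ k * (ln (1 - c) * rGamma (real k + 1) + rGamma_deriv (real k + 1)) * q k))"
      unfolding f_def .
  next
    define x where "x = b * d"
    have x: "x > 0" "x / 2 = w * d" using b d by (simp_all add: x_def w_def)
    \<comment> \<open>Here \<open>ln (1 - c)\<close> is absorbed: it is \<open>2 * ln d\<close>.\<close>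
    have lnx: "2 * ln (x / 2) = 2 * ln w + ln (1 - c)"
      using w d unfolding x(2) d(2)[symmetric] by (simp add: ln_mult ln_realpow)
    have pw: "(x / 2) ^ (2 * k) = w ^ (2 * k) * (1 - c) ^ k" for k
      unfolding x(2) power_mult_distrib using d(2) by (simp add: power_mult)
    have eq: "v k * ((1 - c) ^ k * rGamma (real k + 1) * p k
          + (1 - c) ^ k * (ln (1 - c) * rGamma (real k + 1) + rGamma_deriv (real k + 1)) * q k)
        = (c * w powr (3 / 2)) * ((-1) ^ k * (x / 2) ^ (2 * k) *
            (rGamma (real k + 1) * (rGamma_deriv (real k + 3 / 2) + 2 * ln (x / 2) * rGamma (real k + 3 / 2))
              + rGamma_deriv (real k + 1) * rGamma (real k + 3 / 2)))" for k
      unfolding lnx pw v_def p_def q_def by (simp add: algebra_simps)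
    have "w powr (3 / 2) = w * sqrt w"
      using w powr_add[of w 1 "1 / 2"] by (simp add: powr_half_sqrt)
    then have val: "(c * w powr (3 / 2)) * (4 / (sqrt pi * x) * y) = 2 * c / d * sqrt (b / (2 * pi)) * y" for y
      using b d by (simp add: w_def x_def real_sqrt_divide real_sqrt_mult field_simps)
    show "(\<lambda>k. v k * ((1 - c) ^ k * rGamma (real k + 1) * p k
          + (1 - c) ^ k * (ln (1 - c) * rGamma (real k + 1) + rGamma_deriv (real k + 1)) * q k))
      sums (2 * c / d * sqrt (b / (2 * pi)) * (sin (b * d) * Ci (b * d) - cos (b * d) * Si (b * d)))"
      using sums_mult[OF half_integer_rGamma_product_sums[OF x(1)], of "c * w powr (3 / 2)"]
      unfolding eq val x_def[symmetric] .
  qed (use c L in auto)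
qed

theorem theorem1p2:
  shows "(\<forall>b c :: real. 0 < b \<and> 0 < c \<and> c < 1 \<longrightarrow>
           (let d = sqrt (1 - c) in
             (\<lambda>k. let n = Suc k in
                (b * c) ^ n / (fact (n - 1) * 2 ^ n) *
                  (Bessel_J_deriv (real n - 1 / 2) b
                     - (-1) ^ n * Struve_H_deriv (1 / 2 - real n) b))
             sums (2 * c / d * sqrt (b / (2 * pi)) *
                     (sin (b * d) * Ci (b * d) - cos (b * d) * Si (b * d)))))
       \<and> (\<forall>c :: real. 0 < c \<and> c < 1 \<longrightarrow>
           (let d = sqrt (1 - c) in
             (\<lambda>k. let n = Suc k in
                c ^ n / fact (n - 1) *
                  (Bessel_J_deriv (real n - 1 / 2) 2
                     - (-1) ^ n * Struve_H_deriv (1 / 2 - real n) 2))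
             sums (2 * c / (d * sqrt pi) *
                     (sin (2 * d) * Ci (2 * d) - cos (2 * d) * Si (2 * d)))))"
    (is "?general \<and> ?special")
proof
  show gen: ?general
  proof (intro allI impI)
    fix b c :: real assume bc: "0 < b \<and> 0 < c \<and> c < 1"
    have "real (Suc k) - 1 / 2 = real k + 1 / 2" "1 / 2 - real (Suc k) = - (real k + 1 / 2)" for k
      by simp_all
    then show "let d = sqrt (1 - c) in
             (\<lambda>k. let n = Suc k in
                (b * c) ^ n / (fact (n - 1) * 2 ^ n) *
                  (Bessel_J_deriv (real n - 1 / 2) b
                     - (-1) ^ n * Struve_H_deriv (1 / 2 - real n) b))
             sums (2 * c / d * sqrt (b / (2 * pi)) *
                     (sin (b * d) * Ci (b * d) - cos (b * d) * Si (b * d)))"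
      using Bessel_Struve_deriv_generating_sum[of b c] bc by (simp only: Let_def) simp
  qed
  show ?special
  proof (intro allI impI)
    fix c :: real assume c: "0 < c \<and> c < 1"
    have "(2 * c) ^ Suc k / (fact k * 2 ^ Suc k) = c ^ Suc k / fact k" for k
      by (simp add: power_mult_distrib)
    moreover have "2 * c / d * sqrt (2 / (2 * pi)) = 2 * c / (d * sqrt pi)" for d
      by (simp add: real_sqrt_divide)
    ultimately show "let d = sqrt (1 - c) in
             (\<lambda>k. let n = Suc k in
                c ^ n / fact (n - 1) *
                  (Bessel_J_deriv (real n - 1 / 2) 2
                     - (-1) ^ n * Struve_H_deriv (1 / 2 - real n) 2))
             sums (2 * c / (d * sqrt pi) *
                     (sin (2 * d) * Ci (2 * d) - cos (2 * d) * Si (2 * d)))"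
      using gen[rule_format, of 2 c] c by (simp only: Let_def diff_Suc_1) simp
  qed
qed

end
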